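(* Let $x>0$ be fixed and let $\delta:=1-\frac{1+\log\log 2}{\log 2}\approx 0.08607$. For all sufficiently large primes $p$ (in terms of $x$), the number of even characters $\chi\in X_p^+$ such that $\theta(x,\chi)\neq 0$ is at least $$\gg \frac{p}{\mathcal{E}(\sqrt{p/3})}\gg\frac{p}{(\log p)^{\delta+o(1)}},$$ where the implied constants may depend on $x$ and $o(1)\to 0$ as $p\to+\infty$.
   Context: For a prime $p$, $X_p^+$ denotes the group, of order $\tfrac12(p-1)$, of even Dirichlet characters modulo $p$ (those with $\chi(-1)=1$). For $\chi\in X_p^+$ and $x>0$, $$\theta(x,\chi):=\sum_{n\geqslant 1}\chi(n)e^{-\pi n^2x/p}.$$ For a real number $N\geqslant 1$ and a nonzero tuple of non-negative weights $w=(w(m))_{1\leqslant m\leqslant N}$, put $\|w\|_1=\sum_{m\leqslant N}w(m)$ and $$\mathcal{E}(N,w):=\sum_{\substack{m_1,m_2,n_1,n_2\leqslant N\\ m_1m_2=n_1n_2}}w(m_1)w(m_2)w(n_1)w(n_2),$$ the variables being positive integers. Define $\mathcal{E}(N):=\inf_{w}\frac{N^2\,\mathcal{E}(N,w)}{\|w\|_1^4}$, the infimum being over all such nonzero $w$. *)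

theory Defs
  imports "HOL-Analysis.Analysis" "HOL-Computational_Algebra.Primes"
begin

(* Characters are extended by zero to all integers not coprime to the modulus;
   the value 1 at 1 follows from multiplicativity and the third clause. *)
definition dirichlet_character :: "nat \<Rightarrow> (int \<Rightarrow> complex) \<Rightarrow> bool" where
  "dirichlet_character q chi \<longleftrightarrow>
     (\<forall>a b. chi (a * b) = chi a * chi b) \<and>
     (\<forall>a. chi (a + int q) = chi a) \<and>
     (\<forall>a. chi a \<noteq> 0 \<longleftrightarrow> coprime a (int q))"

definition even_characters :: "nat \<Rightarrow> (int \<Rightarrow> complex) set" where
  "even_characters q = {chi. dirichlet_character q chi \<and> chi (-1) = 1}"

(* The series starts at n = 1, hence the shift of the summation index. *)
definition theta :: "nat \<Rightarrow> real \<Rightarrow> (int \<Rightarrow> complex) \<Rightarrow> complex" where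
  "theta q x chi =
     (\<Sum>n. chi (int (Suc n)) * complex_of_real (exp (- pi * (real (Suc n))\<^sup>2 * x / real q)))"

definition pos_upto :: "real \<Rightarrow> nat set" where
  "pos_upto N = {m. 1 \<le> m \<and> real m \<le> N}"

(* A tuple of weights indexed by pos_upto N is represented by a function on nat
   whose values outside pos_upto N are never used. *)
definition admissible_weight :: "real \<Rightarrow> (nat \<Rightarrow> real) \<Rightarrow> bool" where
  "admissible_weight N w \<longleftrightarrow>
     (\<forall>m\<in>pos_upto N. 0 \<le> w m) \<and> (\<exists>m\<in>pos_upto N. w m \<noteq> 0)"

definition weight_norm :: "real \<Rightarrow> (nat \<Rightarrow> real) \<Rightarrow> real" where
  "weight_norm N w = (\<Sum>m\<in>pos_upto N. w m)"

definition weighted_energy :: "real \<Rightarrow> (nat \<Rightarrow> real) \<Rightarrow> real" where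
  "weighted_energy N w =
     (\<Sum>(m1, m2, n1, n2) \<in> {(m1, m2, n1, n2).
         m1 \<in> pos_upto N \<and> m2 \<in> pos_upto N \<and> n1 \<in> pos_upto N \<and> n2 \<in> pos_upto N \<and>
         m1 * m2 = n1 * n2}.
       w m1 * w m2 * w n1 * w n2)"

(* For N \<ge> 1 the infimum is over a nonempty set of reals bounded below by 0. *)
definition min_energy :: "real \<Rightarrow> real" where
  "min_energy N =
     (INF w \<in> {w. admissible_weight N w}. N\<^sup>2 * weighted_energy N w / weight_norm N w ^ 4)"

definition delta :: real where
  "delta = 1 - (1 + ln (ln 2)) / ln 2"

end

theory Submission
  imports Defs "HOL-Number_Theory.Residue_Primitive_Roots" "HOL-Combinatorics.Permutations"
    "HOL-Real_Asymp.Real_Asymp"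
begin

text \<open>
  Non-vanishing. For a weight \<open>w\<close> on \<open>[1, N]\<close> with \<open>N = sqrt (p/3)\<close> put \<open>M(\<chi>) = \<Sum> w(m) \<chi>(m)\<close>.
  By orthogonality over even characters and positivity, \<open>\<Sum> \<theta>(x, \<chi>) cnj M(\<chi>)\<close> is at least a constant
  times \<open>p \<parallel>w\<parallel>\<close>, the second moment of \<open>\<theta>\<close> is \<open>O(p sqrt p)\<close>, and the fourth moment of \<open>M\<close> is at most
  \<open>p\<close> times the energy of \<open>w\<close>, because \<open>m\<^sub>1 m\<^sub>2 \<equiv> \<plusminus> n\<^sub>1 n\<^sub>2\<close> forces equality for products up to \<open>p/3\<close>.
  Hoelder's inequality bounds the number of non-vanishing values from below for every \<open>w\<close>, hence
  for the infimum.

  Small energy. Let \<open>L = ln N\<close>. Split the primes up to \<open>exp L\<close> into \<open>K\<close> blocks, equally long on the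
  scale of \<open>ln ln\<close>, and let \<open>w\<close> count the representations \<open>m = n q\<close> where \<open>n\<close> is a product of exactly
  \<open>t \<approx> ln ln N / (2 K ln 2)\<close> primes from each block (except for the outermost ones) and \<open>q\<close> is a prime
  of size \<open>N / n\<close>. In \<open>m\<^sub>1 m\<^sub>2 = n\<^sub>1 n\<^sub>2\<close> the primes \<open>q\<close> are matched, and the remaining ones are
  related by a permutation preserving the blocks. If \<open>i\<close> is the number of blocks up to the last one
  in which the permutation mixes the two factors, there are at most
  \<open>((2t)!)^i (t!)^(2(K - i))\<close> such permutations, and since the two matched values of \<open>n\<close> differ by a
  bounded factor, one prime of the last mixed block is confined to a short interval, which saves a
  factor \<open>L^(i/K)\<close>. The choice of \<open>t\<close> makes this saving balance \<open>(2t choose t)^i \<le> 4^(t i)\<close>, so the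
  trivial solutions dominate and the exponent \<open>\<delta>\<close> results. The only input on primes
  is Mertens' first theorem.
\<close>

section \<open>Mertens' first theorem\<close>

lemma prod_primes_dvd:
  fixes n :: nat
  assumes "finite A" "\<And>p. p \<in> A \<Longrightarrow> prime p" "\<And>p. p \<in> A \<Longrightarrow> p dvd n"
  shows "\<Prod>A dvd n"
  using assms
proof (induction A rule: finite_induct)
  case (insert p A)
  have "coprime p (\<Prod>A)"
    using insert by (intro prod_coprime_right primes_coprime) auto
  thus ?case using insert by (simp add: divides_mult)
qed auto

text \<open>Erdos' induction: an even \<open>n > 2\<close> is not prime, and for
  \<open>n = 2 * m + 1\<close> the primes above \<open>m + 1\<close> and up to \<open>n\<close> all
  divide the binomial coefficient \<open>n choose m\<close>, since they divide \<open>n!\<close> but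
  neither \<open>m!\<close> nor \<open>(m + 1)!\<close>.\<close>

lemma primorial_le_four_power: "(\<Prod>p | prime p \<and> p \<le> n. p) \<le> (4::nat) ^ n"
proof (induction n rule: less_induct)
  case (less n)
  have fin: "finite {p::nat. prime p \<and> p \<le> k}" for k
    by (rule finite_subset[of _ "{..k}"]) auto
  consider "n \<le> 1" | "n = 2" | "n > 2" "even n" | "n > 2" "odd n"
    by linarith
  thus ?case
  proof cases
    case 1
    hence e: "{p::nat. prime p \<and> p \<le> n} = {}" by (auto dest: prime_gt_1_nat)
    show ?thesis unfolding e by simp
  next
    case 2
    have "{p::nat. prime p \<and> p \<le> n} = {2}"
      using 2 by (auto dest: prime_ge_2_nat intro: antisym)
    thus ?thesis using 2 by simp
  next
    case 3
    have "\<not> prime n" using 3 primes_dvd_imp_eq[OF two_is_prime_nat, of n] by auto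
    hence "{p::nat. prime p \<and> p \<le> n} = {p. prime p \<and> p \<le> n - 1}"
      using 3 by (auto simp: le_eq_less_or_eq)
    also have "\<Prod>\<dots> \<le> 4 ^ (n - 1)" using 3 less[of "n - 1"] by simp
    also have "(4::nat) ^ (n - 1) \<le> 4 ^ n" by (intro power_increasing) auto
    finally show ?thesis .
  next
    case 4
    then obtain m where m: "n = 2 * m + 1" by (auto elim: oddE)
    have m1: "m \<ge> 1" using 4 m by auto
    let ?A = "{p::nat. prime p \<and> p \<le> m + 1}" and ?B = "{p::nat. prime p \<and> m + 1 < p \<and> p \<le> n}"
    have finB: "finite ?B" by (rule finite_subset[OF _ fin[of n]]) auto
    have split: "{p::nat. prime p \<and> p \<le> n} = ?A \<union> ?B" using m by auto
    have eq: "(n choose m) * (fact m * fact (n - m)) = fact n"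
      using binomial_fact_lemma[of m n] m by (simp add: mult_ac)
    have "prod (\<lambda>p. p) ?B dvd (n choose m)"
    proof (rule prod_primes_dvd[OF finB])
      fix p assume p: "p \<in> ?B"
      have "p dvd (n choose m) * (fact m * fact (n - m))"
        unfolding eq using p prime_dvd_fact_iff by auto
      moreover have "\<not> p dvd fact m" "\<not> p dvd fact (n - m)"
        using p m prime_dvd_fact_iff[of p m] prime_dvd_fact_iff[of p "n - m"] by auto
      ultimately show "p dvd (n choose m)"
        using p prime_dvd_mult_iff[of p] by blast
    qed auto
    moreover have pos: "n choose m > 0" using m by (simp add: zero_less_binomial)
    ultimately have "\<Prod>?B \<le> n choose m" by (intro dvd_imp_le)
    also have "n choose m \<le> 4 ^ m"
    proof -
      \<comment> \<open>The two equal middle coefficients together are at most the row sum 2^n = 2 *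
        4^m.\<close>
      have "(\<Sum>k\<in>{m, m+1}. n choose k) \<le> (\<Sum>k\<le>n. n choose k)"
        using m by (intro sum_mono2) auto
      moreover have "n choose (m + 1) = n choose m"
        using binomial_symmetric[of m n] m by simp
      ultimately have "2 * (n choose m) \<le> 2 ^ n" unfolding choose_row_sum by simp
      also have "(2::nat) ^ n = 2 * 4 ^ m" unfolding m by (simp add: power_mult)
      finally show ?thesis by simp
    qed
    finally have B: "\<Prod>?B \<le> 4 ^ m" .
    have "(\<Prod>p | prime p \<and> p \<le> n. p) = \<Prod>?A * \<Prod>?B"
      unfolding split by (rule prod.union_disjoint) (use fin finB in auto)
    also have "\<dots> \<le> 4 ^ (m + 1) * 4 ^ m"
      using less[of "m+1"] m m1 B by (intro mult_mono) auto
    also have "\<dots> = 4 ^ n" using m by (simp add: power_add mult_2)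
    finally show ?thesis .
  qed
qed

lemma finite_primes_le: "finite {p::nat. prime p \<and> p \<le> n}"
  by (rule finite_subset[of _ "{..n}"]) auto

lemma sum_ln_primes_le: "(\<Sum>p | prime p \<and> p \<le> n. ln (real p)) \<le> real n * ln 4"
proof -
  have "(\<Sum>p | prime p \<and> p \<le> n. ln (real p)) = ln (\<Prod>p | prime p \<and> p \<le> n. real p)"
    by (rule ln_prod[symmetric]) (auto simp: finite_primes_le intro: prime_gt_0_nat)
  also have "\<dots> \<le> ln (4 ^ n)"
  proof (rule ln_mono)
    show "(\<Prod>p | prime p \<and> p \<le> n. real p) \<le> 4 ^ n"
      using primorial_le_four_power[of n]
      by (simp only: of_nat_le_iff[symmetric, where 'a=real] of_nat_prod of_nat_power of_nat_numeral)
    show "0 < (\<Prod>p | prime p \<and> p \<le> n. real p)"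
      by (intro prod_pos) (auto intro: prime_gt_0_nat)
  qed
  finally show ?thesis by (simp add: ln_realpow)
qed

section \<open>Legendre's formula\<close>

text \<open>The von Mangoldt identity: a prime \<open>p\<close> contributes \<open>ln p\<close> once
  for each power \<open>p ^ j\<close> dividing \<open>k\<close>. Bounding \<open>p\<close> and
  \<open>j\<close> by \<open>n\<close> rather than by \<open>k\<close> makes the ranges independent
  of \<open>k\<close>, so that the sums can be interchanged when \<open>k\<close> varies.\<close>

lemma ln_eq_sum_prime_powers:
  assumes "1 \<le> k" "k \<le> n"
  shows "ln (real k) = (\<Sum>p | prime p \<and> p \<le> n. \<Sum>j=1..n. (if p ^ j dvd k then ln (real p) else 0))"
proof -
  have *: "(\<Sum>j=1..n. (if p ^ j dvd k then ln (real p) else 0)) = real (multiplicity p k) * ln (real p)"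
    if p: "prime p" for p
  proof -
    \<comment> \<open>The exponent of \<open>p\<close> in \<open>k\<close> is smaller than
      \<open>k\<close>, so the range of \<open>j\<close> cuts off no power.\<close>
    have "p ^ multiplicity p k \<le> k" using assms by (intro dvd_imp_le multiplicity_dvd) auto
    moreover have "multiplicity p k < p ^ multiplicity p k"
      using p prime_gt_1_nat by (intro power_gt_expt) auto
    ultimately have le: "multiplicity p k \<le> n" using assms by linarith
    have "{j\<in>{1..n}. p ^ j dvd k} = {1..multiplicity p k}"
    proof -
      have *: "p ^ j dvd k \<longleftrightarrow> j \<le> multiplicity p k" for j
      proof (rule power_dvd_iff_le_multiplicity)
        show "k \<noteq> 0" using assms by simp
        show "\<not> is_unit p" using p not_prime_unit by blast
      qed
      show ?thesis unfolding * using le by auto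
    qed
    thus ?thesis by (simp add: sum.If_cases Int_def)
  qed
  have "ln (real k) = ln (\<Prod>p\<in>prime_factors k. real p ^ multiplicity p k)"
    using arg_cong[OF prime_factorization_nat[of k], of "\<lambda>k. ln (real k)"] assms
    by (simp only: of_nat_prod of_nat_power)
  also have "\<dots> = (\<Sum>p\<in>prime_factors k. ln (real p ^ multiplicity p k))"
    by (rule ln_prod) (auto simp: in_prime_factors_iff)
  also have "\<dots> = (\<Sum>p\<in>prime_factors k. real (multiplicity p k) * ln (real p))"
    by (intro sum.cong refl ln_realpow)
  also have "\<dots> = (\<Sum>p | prime p \<and> p \<le> n. real (multiplicity p k) * ln (real p))"
  proof (rule sum.mono_neutral_left)
    show "prime_factors k \<subseteq> {p. prime p \<and> p \<le> n}"
      using assms by (auto simp: in_prime_factors_iff dest!: dvd_imp_le)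
    show "\<forall>i\<in>{p. prime p \<and> p \<le> n} - prime_factors k. real (multiplicity i k) * ln (real i) = 0"
      using assms by (auto simp: in_prime_factors_iff not_dvd_imp_multiplicity_0)
  qed (rule finite_primes_le)
  also have "\<dots> = (\<Sum>p | prime p \<and> p \<le> n. \<Sum>j=1..n. (if p ^ j dvd k then ln (real p) else 0))"
    by (intro sum.cong refl *[symmetric]) auto
  finally show ?thesis .
qed

lemma card_multiples: "d > 0 \<Longrightarrow> card {k\<in>{1..n::nat}. d dvd k} = n div d"
proof -
  assume d: "d > 0"
  have "{k\<in>{1..n}. d dvd k} = (\<lambda>i. d * i) ` {1..n div d}"
    using d by (auto simp: image_iff less_eq_div_iff_mult_less_eq mult.commute elim!: dvdE
        intro!: Suc_leI Nat.gr0I)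
  thus ?thesis using d by (simp add: card_image inj_on_def)
qed

text \<open>Exactly \<open>n div p ^ j\<close> of the factors of \<open>n!\<close> are divisible by
  \<open>p ^ j\<close>.\<close>

lemma ln_fact_eq_sum_primes:
  "ln (fact n :: real) = (\<Sum>p | prime p \<and> p \<le> n. ln (real p) * (\<Sum>j=1..n. real (n div p ^ j)))"
proof -
  have "ln (fact n :: real) = (\<Sum>k=1..n. ln (real k))"
    by (subst fact_prod, simp only: of_nat_prod, subst ln_prod) auto
  also have "\<dots> = (\<Sum>k=1..n. \<Sum>p | prime p \<and> p \<le> n. \<Sum>j=1..n. (if p ^ j dvd k then ln (real p) else 0))"
    by (intro sum.cong refl ln_eq_sum_prime_powers) auto
  also have "\<dots> = (\<Sum>p | prime p \<and> p \<le> n. \<Sum>j=1..n. \<Sum>k=1..n. (if p ^ j dvd k then ln (real p) else 0))"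
    by (subst sum.swap) (intro sum.cong refl sum.swap)
  also have "\<dots> = (\<Sum>p | prime p \<and> p \<le> n. ln (real p) * (\<Sum>j=1..n. real (n div p ^ j)))"
    unfolding sum_distrib_left
  proof (intro sum.cong refl)
    fix p j assume p: "p \<in> {p. prime p \<and> p \<le> n}"
    have "card {k\<in>{1..n}. p ^ j dvd k} = n div p ^ j"
      using p by (intro card_multiples) (auto intro: prime_gt_0_nat)
    thus "(\<Sum>k=1..n. if p ^ j dvd k then ln (real p) else 0) = ln (real p) * real (n div p ^ j)"
      by (simp add: sum.If_cases Int_def mult.commute)
  qed
  finally show ?thesis .
qed

section \<open>Bounds for ln n! and Mertens' estimate\<close>

lemma ln_fact_upper: "ln (fact n :: real) \<le> real n * ln (real n)"
proof (cases "n = 0")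
  case False
  have "(fact n :: real) \<le> real n ^ n" using fact_le_power[of n, where 'a=real] by simp
  hence "ln (fact n :: real) \<le> ln (real n ^ n)" using False by (intro ln_mono) auto
  thus ?thesis using False by (simp add: ln_realpow)
qed auto

lemma ln_fact_lower: "real n * ln (real n) - real n \<le> ln (fact n :: real)"
proof (cases "n = 0")
  case False
  \<comment> \<open>A single term of the exponential series is at most the whole sum.\<close>
  have "real n ^ n / fact n \<le> exp (real n)"
    using sum_le_suminf[OF summable_exp_generic[of "real n"], of "{n}"]
    by (simp add: exp_def field_simps)
  hence "real n ^ n \<le> exp (real n) * fact n" by (simp add: field_simps)
  hence "ln (real n ^ n) \<le> ln (exp (real n) * fact n)" using False by (intro ln_mono) auto
  thus ?thesis using False by (simp add: ln_realpow ln_mult)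
qed auto

text \<open>The subtracted term bounds the tail of the series and lets the induction close. In
  Mertens' theorem this series majorizes the contribution of the higher prime powers.\<close>

lemma sum_ln_over_consecutive_product_le:
  "n \<ge> 1 \<Longrightarrow> (\<Sum>m=2..n. ln (real m) / (real m * (real m - 1))) \<le> 2 - (ln (real n) + 2) / real n"
proof (induction n rule: nat_induct_at_least)
  case (Suc n)
  have n: "real n \<ge> 1" using Suc by simp
  have "ln (real (Suc n)) - ln (real n) = ln (real (Suc n) / real n)"
    using n by (simp add: ln_div)
  also have "\<dots> = ln (1 + 1 / real n)" using n by (intro arg_cong[of _ _ ln]) (simp add: field_simps)
  also have "\<dots> \<le> 1 / real n" using n by (intro ln_add_one_self_le_self) auto
  finally have d: "ln (real (Suc n)) \<le> ln (real n) + 1 / real n" by simp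
  have "ln (real (Suc n)) / (real (Suc n) * (real (Suc n) - 1)) \<le>
        (ln (real n) + 2) / real n - (ln (real (Suc n)) + 2) / real (Suc n)"
  proof -
    let ?b = "ln (real (Suc n))"
    have "(real n + 1) * (?b - 1 / real n + 2) - real n * (?b + 2) \<le>
          (real n + 1) * (ln (real n) + 2) - real n * (?b + 2)"
      using d n by (intro diff_right_mono mult_left_mono) auto
    moreover have "(real n + 1) * (?b - 1 / real n + 2) - real n * (?b + 2) = ?b + 1 - 1 / real n"
      using n by (simp add: field_simps)
    moreover have "1 / real n \<le> 1" using n by simp
    ultimately have "?b \<le> (real n + 1) * (ln (real n) + 2) - real n * (?b + 2)" by linarith
    hence "?b / (real n * (real n + 1)) \<le> ((real n + 1) * (ln (real n) + 2) - real n * (?b + 2)) / (real n * (real n + 1))"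
      using n by (intro divide_right_mono) auto
    also have "\<dots> = (ln (real n) + 2) / real n - (?b + 2) / (real n + 1)"
      using n by (simp add: diff_divide_distrib)
    finally show ?thesis by (simp add: mult.commute add.commute)
  qed
  moreover have "(\<Sum>m=2..Suc n. ln (real m) / (real m * (real m - 1))) =
     (\<Sum>m=2..n. ln (real m) / (real m * (real m - 1))) + ln (real (Suc n)) / (real (Suc n) * (real (Suc n) - 1))"
    using Suc by (subst sum.nat_ivl_Suc') auto
  ultimately show ?case using Suc.IH by linarith
qed simp

text \<open>Legendre's formula is compared with the elementary bounds for ln n!. For the upper bound
  only \<open>j = 1\<close> is kept, and the rounding errors are controlled by the primorial bound.
  For the lower bound the geometric series over \<open>j\<close> gives \<open>n / (p - 1)\<close>,
  whose excess over \<open>n / p\<close> is summable.\<close>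

lemma sum_ln_prime_div_nat:
  assumes "n \<ge> 1"
  shows "(\<Sum>p | prime p \<and> p \<le> n. ln (real p) / real p) \<le> ln (real n) + ln 4"
    and "(\<Sum>p | prime p \<and> p \<le> n. ln (real p) / real p) \<ge> ln (real n) - 3"
proof -
  let ?P = "{p. prime p \<and> p \<le> n}"
  let ?M = "\<Sum>p\<in>?P. ln (real p) / real p"
  have n: "real n \<ge> 1" using assms by simp
  have pp: "real p \<ge> 2" "ln (real p) \<ge> 0" if "p \<in> ?P" for p
  proof -
    have "p \<ge> 2" using that prime_ge_2_nat by blast
    thus "real p \<ge> 2" "ln (real p) \<ge> 0" by auto
  qed
  have "real n * ?M - real n * ln 4 \<le> real n * ?M - (\<Sum>p\<in>?P. ln (real p))"
    using sum_ln_primes_le[of n] by simp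
  also have "\<dots> = (\<Sum>p\<in>?P. ln (real p) * (real n / real p - 1))"
    by (simp add: sum_distrib_left sum_subtractf algebra_simps)
  also have "\<dots> \<le> (\<Sum>p\<in>?P. ln (real p) * (\<Sum>j=1..n. real (n div p ^ j)))"
  proof (intro sum_mono mult_left_mono)
    fix p assume p: "p \<in> ?P"
    have "real n / real p - 1 \<le> real (n div p)"
      using floor_divide_of_nat_eq[of n p, where 'a=real] floor_correct[of "real n / real p"] by linarith
    also have "\<dots> = (\<Sum>j\<in>{1}. real (n div p ^ j))" by simp
    also have "\<dots> \<le> (\<Sum>j=1..n. real (n div p ^ j))"
      using assms by (intro sum_mono2) auto
    finally show "real n / real p - 1 \<le> (\<Sum>j=1..n. real (n div p ^ j))" .
  qed (use pp in auto)
  also have "\<dots> \<le> real n * ln (real n)"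
    using ln_fact_upper[of n] unfolding ln_fact_eq_sum_primes .
  finally have "real n * ?M \<le> real n * (ln (real n) + ln 4)" by (simp add: algebra_simps)
  thus "?M \<le> ln (real n) + ln 4" using n by simp

  have "real n * ln (real n) - real n \<le> (\<Sum>p\<in>?P. ln (real p) * (\<Sum>j=1..n. real (n div p ^ j)))"
    using ln_fact_lower[of n] unfolding ln_fact_eq_sum_primes .
  also have "\<dots> \<le> (\<Sum>p\<in>?P. ln (real p) * (real n / (real p - 1)))"
  proof (intro sum_mono mult_left_mono)
    fix p assume p: "p \<in> ?P"
    have "(\<Sum>j=1..n. real (n div p ^ j)) \<le> (\<Sum>j=1..n. real n * (1 / real p) ^ j)"
    proof (intro sum_mono)
      fix j
      have "real (n div p ^ j) \<le> real n / real (p ^ j)"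
        using floor_divide_of_nat_eq[of n "p ^ j", where 'a=real] floor_correct[of "real n / real (p ^ j)"] by linarith
      thus "real (n div p ^ j) \<le> real n * (1 / real p) ^ j" by (simp add: power_divide)
    qed
    also have "\<dots> = real n * ((1 / real p) * (\<Sum>j<n. (1 / real p) ^ j))"
      unfolding sum_distrib_left[symmetric]
      by (simp add: sum.shift_bounds_cl_nat_ivl sum.atLeast_Suc_atMost_Suc_shift atLeast0AtMost lessThan_Suc_atMost
          sum_distrib_left sum.atLeast1_atMost_eq)
    also have "\<dots> = real n * ((1 / real p) * ((1 - (1 / real p) ^ n) / (1 - 1 / real p)))"
      using pp[OF p] by (subst sum_gp_strict) auto
    also have "\<dots> \<le> real n * ((1 / real p) * (1 / (1 - 1 / real p)))"
      using pp[OF p] by (intro mult_left_mono divide_right_mono) auto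
    also have "\<dots> = real n / (real p - 1)"
      using pp[OF p] by (simp add: field_simps)
    finally show "(\<Sum>j=1..n. real (n div p ^ j)) \<le> real n / (real p - 1)" .
  qed (use pp in auto)
  also have "\<dots> = real n * ?M + real n * (\<Sum>p\<in>?P. ln (real p) / (real p * (real p - 1)))"
    unfolding sum_distrib_left sum.distrib[symmetric]
  proof (intro sum.cong refl)
    fix p assume p: "p \<in> ?P"
    have "real p > 1" using pp[OF p] by simp
    thus "ln (real p) * (real n / (real p - 1)) =
         real n * (ln (real p) / real p) + real n * (ln (real p) / (real p * (real p - 1)))"
      by (simp add: divide_simps) (simp add: algebra_simps)
  qed
  also have "(\<Sum>p\<in>?P. ln (real p) / (real p * (real p - 1))) \<le>
       (\<Sum>m=2..n. ln (real m) / (real m * (real m - 1)))"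
    by (intro sum_mono2) (auto dest: prime_ge_2_nat)
  also have "\<dots> \<le> 2 - (ln (real n) + 2) / real n"
    by (rule sum_ln_over_consecutive_product_le[OF assms])
  also have "\<dots> \<le> 2" using n by simp
  finally have "real n * (ln (real n) - 3) \<le> real n * ?M"
    using n by (simp add: algebra_simps)
  thus "?M \<ge> ln (real n) - 3" using n by simp
qed

lemma finite_primes_real_le: "finite {p::nat. prime p \<and> real p \<le> x}"
proof (rule finite_subset)
  show "{p::nat. prime p \<and> real p \<le> x} \<subseteq> {..nat \<lfloor>x\<rfloor>}"
    by (auto simp: le_nat_floor)
qed auto

theorem mertens_first:
  fixes x :: real
  assumes "x \<ge> 1"
  shows "\<bar>(\<Sum>p | prime p \<and> real p \<le> x. ln (real p) / real p) - ln x\<bar> \<le> 4"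
proof -
  define n where "n = nat \<lfloor>x\<rfloor>"
  have n: "n \<ge> 1" "real n \<le> x" "x < real n + 1"
    using assms unfolding n_def by linarith+
  have eq: "{p. prime p \<and> real p \<le> x} = {p. prime p \<and> p \<le> n}"
    using n by auto
  have "ln (real n) \<le> ln x" using n assms by (intro ln_mono) auto
  \<comment> \<open>Since \<open>x < n + 1 \<le> 2 * n\<close>, passing from \<open>x\<close> to its
    floor costs at most \<open>ln 2\<close>.\<close>
  moreover have "ln x \<le> ln (2 * real n)" using n assms by (intro ln_mono) linarith+
  hence "ln x \<le> ln 2 + ln (real n)" using n by (simp add: ln_mult)
  moreover have "ln 2 \<le> (1::real)" using ln_le_minus_one[of "2::real"] by simp
  moreover have "ln 4 \<le> (3::real)" using ln_le_minus_one[of "4::real"] by simp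
  ultimately show ?thesis
    using sum_ln_prime_div_nat[OF n(1)] unfolding eq by linarith
qed

section \<open>Sums over primes in intervals\<close>

lemma sum_ln_prime_div_half_open:
  fixes a b :: real
  assumes "1 \<le> a" "a \<le> b"
  shows "(\<Sum>p | prime p \<and> a < real p \<and> real p \<le> b. ln (real p) / real p) \<ge> ln (b / a) - 8"
    and "(\<Sum>p | prime p \<and> a < real p \<and> real p \<le> b. ln (real p) / real p) \<le> ln (b / a) + 8"
proof -
  let ?I = "{p. prime p \<and> a < real p \<and> real p \<le> b}"
  have "{p. prime p \<and> real p \<le> b} = {p. prime p \<and> real p \<le> a} \<union> ?I"
    using assms by auto
  moreover have "finite ?I" by (rule finite_subset[OF _ finite_primes_real_le[of b]]) auto
  ultimately have "(\<Sum>p | prime p \<and> real p \<le> b. ln (real p) / real p) =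
     (\<Sum>p | prime p \<and> real p \<le> a. ln (real p) / real p) + (\<Sum>p\<in>?I. ln (real p) / real p)"
    by (metis (no_types, lifting) disjoint_iff finite_primes_real_le mem_Collect_eq not_less sum.union_disjoint)
  thus "(\<Sum>p\<in>?I. ln (real p) / real p) \<ge> ln (b / a) - 8" "(\<Sum>p\<in>?I. ln (real p) / real p) \<le> ln (b / a) + 8"
    using mertens_first[of a] mertens_first[of b] assms by (auto simp: ln_div)
qed

lemma sum_ln_prime_div_closed_le:
  fixes a b :: real
  assumes "0 < a" "a \<le> b"
  shows "(\<Sum>p | prime p \<and> a \<le> real p \<and> real p \<le> b. ln (real p) / real p) \<le> ln (b / a) + 9"
proof -
  let ?J = "{p::nat. prime p \<and> a \<le> real p \<and> real p \<le> b}"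
  consider "b < 1" | "a < 1" "b \<ge> 1" | "a \<ge> 1" by linarith
  thus ?thesis
  proof cases
    case 1
    have e: "?J = {}" using 1 by (auto dest: prime_ge_1_nat)
    show ?thesis unfolding e using assms by (simp add: ln_div ln_mono)
  next
    case 2
    have "(\<Sum>p\<in>?J. ln (real p) / real p) \<le> (\<Sum>p | prime p \<and> real p \<le> b. ln (real p) / real p)"
      by (intro sum_mono2 finite_primes_real_le) (auto dest: prime_ge_1_nat)
    moreover have "ln a \<le> 0" using 2 assms by simp
    moreover have "ln (b / a) = ln b - ln a" using 2 assms by (simp add: ln_div)
    ultimately show ?thesis using mertens_first[of b] 2 by linarith
  next
    case 3
    let ?I = "{p. prime p \<and> a < real p \<and> real p \<le> b}"
    have fin: "finite ?I" by (rule finite_subset[OF _ finite_primes_real_le[of b]]) auto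
    define q where "q = nat \<lfloor>a\<rfloor>"
    have q: "q \<ge> 1" unfolding q_def using 3 by linarith
    have sub: "?J \<subseteq> insert q ?I"
    proof
      fix p assume p: "p \<in> ?J"
      show "p \<in> insert q ?I"
      proof (cases "a = real p")
        case True
        thus ?thesis by (simp add: q_def)
      next
        case False
        thus ?thesis using p by simp
      qed
    qed
    have "ln (real q) \<le> real q - 1" using ln_le_minus_one[of "real q"] q by simp
    hence q1: "ln (real q) / real q \<le> 1" using q by simp
    have "(\<Sum>p\<in>?J. ln (real p) / real p) \<le> (\<Sum>p\<in>insert q ?I. ln (real p) / real p)"
      using fin q 3 by (intro sum_mono2 sub) auto
    also have "\<dots> \<le> ln (real q) / real q + (\<Sum>p\<in>?I. ln (real p) / real p)"
      using fin q by (cases "q \<in> ?I") (simp_all add: insert_absorb)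
    also have "\<dots> \<le> 1 + (\<Sum>p\<in>?I. ln (real p) / real p)"
      using q1 by simp
    finally show ?thesis using sum_ln_prime_div_half_open(2)[OF 3 assms(2)] by linarith
  qed
qed

text \<open>Induction over \<open>k\<close> intervals of length \<open>h\<close> on the ln ln scale.
  In the one from \<open>a\<close> to \<open>b\<close>, where ln b = e^h ln a, dividing Mertens'
  lower bound by ln b leaves 1 - e^(-h) - 8 / ln b.\<close>

lemma sum_prime_reciprocals_blocks_ge:
  fixes Y h :: real
  assumes "Y > 0" "h > 0"
  shows "(\<Sum>p | prime p \<and> exp Y < real p \<and> real p \<le> exp (Y * exp (real k * h)). 1 / real p)
           \<ge> real k * (1 - exp (- h) - 8 / Y)"
proof (induction k)
  case 0
  show ?case using assms by (auto intro!: sum_nonneg)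
next
  case (Suc k)
  define a b where "a = exp (Y * exp (real k * h))" and "b = exp (Y * exp (real (Suc k) * h))"
  let ?I = "\<lambda>a b. {p. prime p \<and> a < real p \<and> real p \<le> b}"
  have fin: "finite (?I u v)" for u v
    by (rule finite_subset[OF _ finite_primes_real_le[of v]]) auto
  have ya: "exp Y \<le> a" "1 \<le> a" unfolding a_def using assms by (auto simp: mult_le_cancel_left1)
  have ab: "a \<le> b" unfolding a_def b_def using assms by simp
  have lb: "ln b = Y * exp (real (Suc k) * h)" "ln a = Y * exp (real k * h)" unfolding a_def b_def by simp_all
  have lbpos: "ln b > 0" using assms lb by simp
  have lbY: "ln b \<ge> Y" unfolding lb using assms by (auto simp: mult_le_cancel_left1)
  have "1 - exp (- h) - 8 / Y \<le> 1 - exp (-h) - 8 / ln b"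
    using lbY assms by (simp add: frac_le)
  also have "\<dots> = (ln (b / a) - 8) / ln b"
  proof -
    have "exp (- h) * ln b = ln a"
      unfolding lb by (simp add: algebra_simps flip: exp_add)
    thus ?thesis using lbpos ya ab by (simp add: ln_div field_simps)
  qed
  also have "\<dots> \<le> (\<Sum>p\<in>?I a b. ln (real p) / real p) / ln b"
    using sum_ln_prime_div_half_open(1)[OF ya(2) ab] lbpos by (intro divide_right_mono) auto
  also have "\<dots> = (\<Sum>p\<in>?I a b. (ln (real p) / ln b) * (1 / real p))"
    by (simp add: sum_divide_distrib mult_ac)
  also have "\<dots> \<le> (\<Sum>p\<in>?I a b. 1 * (1 / real p))"
  proof (intro sum_mono mult_right_mono)
    fix p assume p: "p \<in> ?I a b"
    hence "ln (real p) \<le> ln b" using ya by (intro ln_mono) auto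
    thus "ln (real p) / ln b \<le> 1" using lbpos by simp
  qed auto
  finally have *: "1 - exp (- h) - 8 / Y \<le> (\<Sum>p\<in>?I a b. 1 / real p)" by simp
  have "?I (exp Y) b = ?I (exp Y) a \<union> ?I a b" using ya ab by auto
  hence "(\<Sum>p\<in>?I (exp Y) b. 1 / real p) = (\<Sum>p\<in>?I (exp Y) a \<union> ?I a b. 1 / real p)" by simp
  also have "\<dots> = (\<Sum>p\<in>?I (exp Y) a. 1 / real p) + (\<Sum>p\<in>?I a b. 1 / real p)"
    by (rule sum.union_disjoint) (use fin in auto)
  also have "\<dots> \<ge> real k * (1 - exp (- h) - 8 / Y) + (1 - exp (- h) - 8 / Y)"
    using * Suc.IH unfolding a_def[symmetric] by (intro add_mono)
  finally show ?case unfolding b_def[symmetric] by (simp add: distrib_right)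
qed

text \<open>As \<open>h\<close> tends to 0, (1 - e^(-h)) / h tends to 1, so a fixed small
  \<open>h\<close> and about \<open>l / h\<close> intervals suffice. Uniformity in \<open>Y\<close>
  lets one choice of \<open>l\<close> serve all blocks at once.\<close>

lemma sum_prime_reciprocals_block_asymp:
  fixes \<eta> :: real
  assumes "\<eta> > 0"
  shows "\<forall>\<^sub>F l in at_top. \<forall>Y\<ge>exp l.
    (\<Sum>p | prime p \<and> exp Y < real p \<and> real p \<le> exp (Y * exp l). 1 / real p) \<ge> (1 - \<eta>) * l"
proof -
  have "((\<lambda>h::real. (1 - exp (- h)) / h) \<longlongrightarrow> 1) (at_right 0)" by real_asymp
  hence "\<forall>\<^sub>F h in at_right 0. (1 - exp (- h)) / h > 1 - \<eta>"
    using assms by (intro order_tendstoD(1)[of _ 1]) auto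
  moreover have "\<forall>\<^sub>F h::real in at_right 0. h > 0" by (simp add: eventually_at_right_less)
  ultimately have "\<forall>\<^sub>F h in at_right 0. (1 - exp (- h)) / h > 1 - \<eta> \<and> h > 0"
    by eventually_elim auto
  then obtain h :: real where h: "(1 - exp (- h)) / h > 1 - \<eta>" "h > 0"
    by (metis (mono_tags, lifting) eventually_happens' trivial_limit_at_right_real)
  have "((\<lambda>l::real. (l / h - 1) * (1 - exp (- h) - 8 * exp (- l)) / l) \<longlongrightarrow> inverse h * (1 - exp (- h))) at_top"
    using h(2) by real_asymp
  hence "((\<lambda>l::real. (l / h - 1) * (1 - exp (- h) - 8 * exp (- l)) / l) \<longlongrightarrow> (1 - exp (- h)) / h) at_top"
    by (simp only: divide_inverse mult.commute)
  hence "\<forall>\<^sub>F l in at_top. (l / h - 1) * (1 - exp (- h) - 8 * exp (- l)) / l > 1 - \<eta>"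
    using h(1) by (intro order_tendstoD(1))
  moreover have "((\<lambda>l::real. 1 - exp (- h) - 8 * exp (- l)) \<longlongrightarrow> 1 - exp (- h)) at_top"
    by real_asymp
  hence "\<forall>\<^sub>F l in at_top. 1 - exp (- h) - 8 * exp (- l) > 0"
    by (rule order_tendstoD(1)) (use h(2) in simp)
  ultimately show ?thesis using eventually_gt_at_top[of 0]
  proof eventually_elim
    case (elim l)
    show ?case
    proof (intro allI impI)
      fix Y :: real assume Y: "Y \<ge> exp l"
      have Ypos: "Y > 0" using Y exp_gt_zero[of l] by linarith
      define k where "k = nat \<lfloor>l / h\<rfloor>"
      have lh: "l / h > 0" using elim h by simp
      have k: "real k \<ge> l / h - 1" "real k \<le> l / h" unfolding k_def using lh by linarith+
      have kh: "real k * h \<le> l" using k(2) h by (simp add: field_simps)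
      have "(1 - \<eta>) * l \<le> (l / h - 1) * (1 - exp (- h) - 8 * exp (- l))"
        using elim by (simp add: field_simps)
      also have "\<dots> \<le> real k * (1 - exp (- h) - 8 * exp (- l))"
        using k elim by (intro mult_right_mono) auto
      also have "\<dots> \<le> real k * (1 - exp (- h) - 8 / Y)"
        using Y Ypos by (intro mult_left_mono) (auto simp: exp_minus field_simps)
      also have "\<dots> \<le> (\<Sum>p | prime p \<and> exp Y < real p \<and> real p \<le> exp (Y * exp (real k * h)). 1 / real p)"
        by (rule sum_prime_reciprocals_blocks_ge[OF Ypos h(2)])
      also have "\<dots> \<le> (\<Sum>p | prime p \<and> exp Y < real p \<and> real p \<le> exp (Y * exp l). 1 / real p)"
      proof (intro sum_mono2)
        have "exp (Y * exp (real k * h)) \<le> exp (Y * exp l)" using kh Ypos by simp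
        thus "{p. prime p \<and> exp Y < real p \<and> real p \<le> exp (Y * exp (real k * h))}
          \<subseteq> {p. prime p \<and> exp Y < real p \<and> real p \<le> exp (Y * exp l)}"
          by (blast intro: order_trans)
      qed (auto intro: finite_subset[OF _ finite_primes_real_le[of "exp (Y * exp l)"]])
      finally show "(1 - \<eta>) * l \<le> (\<Sum>p | prime p \<and> exp Y < real p \<and> real p \<le> exp (Y * exp l). 1 / real p)" .
    qed
  qed
qed

section \<open>Multiplicative energy of products of primes from blocks\<close>

text \<open>By unique factorization the two families have the same multiset of values.\<close>

lemma equal_prime_products_imp_permutes:
  fixes R R' :: "'d \<Rightarrow> nat"
  assumes "finite D" "\<And>d. d \<in> D \<Longrightarrow> prime (R d)" "\<And>d. d \<in> D \<Longrightarrow> prime (R' d)"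
    and "prod R' D = prod R D"
  obtains \<sigma> where "\<sigma> permutes D" "\<forall>d\<in>D. R' d = R (\<sigma> d)"
proof -
  have pf: "prime_factorization (prod f D) = image_mset f (mset_set D)"
    if "\<And>d. d \<in> D \<Longrightarrow> prime (f d)" for f :: "'d \<Rightarrow> nat"
    unfolding prod_unfold_prod_mset
    by (rule prime_factorization_prod_mset_primes) (use that assms(1) in auto)
  have "image_mset R' (mset_set D) = image_mset R (mset_set D)"
    using pf[of R] pf[of R'] assms by simp
  from image_mset_eq_implies_permutes[OF assms(1) this] show ?thesis
    using that by metis
qed

text \<open>Such a permutation is determined by its restrictions to the fibres of
  \<open>lab\<close>, and each restriction permutes its fibre.\<close>

lemma card_label_preserving_permutations:
  assumes "finite D" "finite C" "lab ` D \<subseteq> C"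
  shows "card {\<sigma>. \<sigma> permutes D \<and> (\<forall>d\<in>D. lab (\<sigma> d) = lab d)} \<le> (\<Prod>c\<in>C. fact (card {d\<in>D. lab d = c}))"
proof -
  let ?fib = "\<lambda>c. {d\<in>D. lab d = c}"
  let ?F = "\<lambda>\<sigma>. \<lambda>c\<in>C. \<lambda>d. if d \<in> ?fib c then \<sigma> d else d"
  let ?S = "{\<sigma>. \<sigma> permutes D \<and> (\<forall>d\<in>D. lab (\<sigma> d) = lab d)}"
  have "card ?S \<le> card (PiE C (\<lambda>c. {\<pi>. \<pi> permutes ?fib c}))"
  proof (rule card_inj_on_le)
    show "inj_on ?F ?S"
    proof (rule inj_onI, rule ext)
      fix \<sigma> \<tau> d assume st: "\<sigma> \<in> ?S" "\<tau> \<in> ?S" "?F \<sigma> = ?F \<tau>"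
      show "\<sigma> d = \<tau> d"
      proof (cases "d \<in> D")
        case True
        hence "lab d \<in> C" using assms by auto
        thus ?thesis using fun_cong[OF fun_cong[OF st(3)], of "lab d" d] True by simp
      next
        case False
        thus ?thesis using st by (auto simp: permutes_def)
      qed
    qed
    show "?F ` ?S \<subseteq> PiE C (\<lambda>c. {\<pi>. \<pi> permutes ?fib c})"
    proof (intro image_subsetI PiE_I)
      fix \<sigma> c assume s: "\<sigma> \<in> ?S" and c: "c \<in> C"
      let ?\<pi> = "\<lambda>d. if d \<in> ?fib c then \<sigma> d else d"
      have maps: "\<sigma> d \<in> ?fib c" if "d \<in> ?fib c" for d
        using s that by (auto simp: permutes_in_image)
      have inj: "inj_on ?\<pi> (?fib c)"
        using s permutes_inj_on[of \<sigma> D] by (auto simp: inj_on_def)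
      have sub: "?\<pi> ` ?fib c \<subseteq> ?fib c" using maps by auto
      have "finite (?fib c)" using assms(1) by simp
      from endo_inj_surj[OF this sub inj] inj have "bij_betw ?\<pi> (?fib c) (?fib c)"
        unfolding bij_betw_def by (rule conjI[rotated])
      hence "?\<pi> permutes ?fib c" by (rule bij_imp_permutes) auto
      thus "?F \<sigma> c \<in> {\<pi>. \<pi> permutes ?fib c}" using c by simp
    qed auto
    show "finite (PiE C (\<lambda>c. {\<pi>. \<pi> permutes ?fib c}))"
      using assms by (intro finite_PiE) (auto intro: finite_permutations)
  qed
  also have "\<dots> = (\<Prod>c\<in>C. fact (card (?fib c)))"
    using assms by (subst card_PiE) (auto intro!: prod.cong card_permutations)
  finally show ?thesis .
qed

definition near :: "real \<Rightarrow> nat \<Rightarrow> nat \<Rightarrow> bool" where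
  "near A a b \<longleftrightarrow> real a \<le> A * real b \<and> real b \<le> A * real a"

text \<open>If some index of \<open>D\<^sub>0\<close> is not hit by \<open>\<sigma>\<close> from within \<open>D\<^sub>0\<close>, the corresponding factor enters
  only one side of the proximity condition, which confines it to a short interval.\<close>

lemma near_permuted_sum_le:
  fixes Q :: "'d \<Rightarrow> nat set"
  assumes D: "finite D" "\<And>d. d \<in> D \<Longrightarrow> finite (Q d)" "\<And>d p. d \<in> D \<Longrightarrow> p \<in> Q d \<Longrightarrow> p > 0"
    and s: "\<sigma> permutes D" "D0 \<subseteq> D" "d0 \<in> D0" "d0 \<notin> \<sigma> ` D0" and A: "A > 0"
    and G: "\<And>z. z > 0 \<Longrightarrow> (\<Sum>p | p \<in> Q d0 \<and> z \<le> real p \<and> real p \<le> A\<^sup>2 * z. 1 / real p) \<le> G"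
  shows "(\<Sum>R | R \<in> PiE D Q \<and> near A (\<Prod>d\<in>D0. R d) (\<Prod>d\<in>D0. R (\<sigma> d)). \<Prod>d\<in>D. 1 / real (R d))
           \<le> G * (\<Prod>d\<in>D - {d0}. \<Sum>p\<in>Q d. 1 / real p)"
proof -
  define D' where "D' = D - {d0}"
  have d0: "d0 \<in> D" "d0 \<notin> D'" "D = insert d0 D'" "finite D'" "D' \<subseteq> D"
    using s D unfolding D'_def by auto
  have finQ': "finite (PiE D' Q)" using d0 D by (intro finite_PiE) auto
  define c where "c R \<longleftrightarrow> near A (\<Prod>d\<in>D0. R d) (\<Prod>d\<in>D0. R (\<sigma> d))" for R
  define F where "F R = (if c R then \<Prod>d\<in>D. 1 / real (R d) else 0)" for R
  have "(\<Sum>R | R \<in> PiE D Q \<and> c R. \<Prod>d\<in>D. 1 / real (R d)) = (\<Sum>R\<in>PiE D Q. F R)"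
    unfolding F_def using D by (subst sum.inter_filter[symmetric]) (auto intro: finite_PiE)
  also have "\<dots> = (\<Sum>(y, g)\<in>Q d0 \<times> PiE D' Q. F (g(d0 := y)))"
    unfolding d0(3) PiE_insert_eq
    by (subst sum.reindex[OF inj_combinator[OF d0(2)]]) (simp add: case_prod_unfold)
  \<comment> \<open>The prime at \<open>d0\<close> becomes the innermost variable, with all other
    primes fixed in \<open>g\<close>.\<close>
  also have "\<dots> = (\<Sum>g\<in>PiE D' Q. \<Sum>y\<in>Q d0. F (g(d0 := y)))"
    by (subst sum.cartesian_product[symmetric], subst sum.swap, rule refl)
  also have "\<dots> \<le> (\<Sum>g\<in>PiE D' Q. G * (\<Prod>d\<in>D'. 1 / real (g d)))"
  proof (rule sum_mono)
    fix g assume g: "g \<in> PiE D' Q"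
    have gpos: "g d > 0" if "d \<in> D'" for d
      using g that D d0 by (blast dest: PiE_mem)
    define n0 where "n0 = (\<Prod>d\<in>D0 - {d0}. g d)"
    define nn where "nn = (\<Prod>d\<in>D0. g (\<sigma> d))"
    \<comment> \<open>With \<open>y\<close> at position \<open>d0\<close> the two compared products
      are \<open>y * n0\<close> and \<open>nn\<close>, so being near forces \<open>y\<close> to lie
      between \<open>z\<close> and \<open>A\<^sup>2 * z\<close>.\<close>
    define z where "z = real nn / (A * real n0)"
    have finD0: "finite D0" using D s by (auto intro: finite_subset)
    have sg: "\<sigma> d \<in> D'" if "d \<in> D0" for d
      using that s permutes_in_image[OF s(1)] unfolding D'_def by (auto intro: image_eqI)
    have n0: "n0 > 0" unfolding n0_def using s gpos by (intro prod_pos) (auto simp: D'_def)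
    have nn: "nn > 0" unfolding nn_def using sg gpos by (intro prod_pos) auto
    have z: "z > 0" unfolding z_def using n0 nn A by simp
    have F: "F (g(d0 := y)) = (if c (g(d0 := y)) then 1 / real y * (\<Prod>d\<in>D'. 1 / real (g d)) else 0)" for y
    proof -
      have "(\<Prod>d\<in>D'. 1 / real ((g(d0 := y)) d)) = (\<Prod>d\<in>D'. 1 / real (g d))"
        using d0 by (intro prod.cong) auto
      thus ?thesis unfolding F_def using d0 by simp
    qed
    have cz: "z \<le> real y \<and> real y \<le> A\<^sup>2 * z" if "c (g(d0 := y))" for y
    proof -
      have "(\<Prod>d\<in>D0. (g(d0 := y)) d) = y * n0"
        unfolding n0_def using finD0 s(3) by (subst prod.remove[of _ d0]) (auto intro!: prod.cong)
      moreover have "(\<Prod>d\<in>D0. (g(d0 := y)) (\<sigma> d)) = nn"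
        unfolding nn_def using sg d0 by (intro prod.cong) auto
      ultimately have "real (y * n0) \<le> A * real nn" "real nn \<le> A * real (y * n0)"
        using that unfolding c_def near_def by auto
      thus ?thesis using n0 A unfolding z_def
        by (simp add: field_simps power2_eq_square)
    qed
    have "(\<Sum>y\<in>Q d0. F (g(d0 := y))) \<le> (\<Sum>y\<in>Q d0. if z \<le> real y \<and> real y \<le> A\<^sup>2 * z then 1 / real y * (\<Prod>d\<in>D'. 1 / real (g d)) else 0)"
      unfolding F using cz by (intro sum_mono) (auto intro!: divide_nonneg_nonneg prod_nonneg)
    also have "\<dots> = (\<Sum>y | y \<in> Q d0 \<and> z \<le> real y \<and> real y \<le> A\<^sup>2 * z. 1 / real y * (\<Prod>d\<in>D'. 1 / real (g d)))"
      using D(2)[OF d0(1)] by (rule sum.inter_filter[symmetric])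
    also have "\<dots> = (\<Sum>y | y \<in> Q d0 \<and> z \<le> real y \<and> real y \<le> A\<^sup>2 * z. 1 / real y) * (\<Prod>d\<in>D'. 1 / real (g d))"
      by (rule sum_distrib_right[symmetric])
    also have "\<dots> \<le> G * (\<Prod>d\<in>D'. 1 / real (g d))"
      by (intro mult_right_mono G z prod_nonneg) auto
    finally show "(\<Sum>y\<in>Q d0. F (g(d0 := y))) \<le> G * (\<Prod>d\<in>D'. 1 / real (g d))" .
  qed
  also have "\<dots> = G * (\<Prod>d\<in>D'. \<Sum>p\<in>Q d. 1 / real p)"
    using d0 D by (subst prod_sum_PiE) (auto simp: sum_distrib_left)
  finally show ?thesis unfolding c_def D'_def .
qed

text \<open>\<open>G (Suc i)\<close> bounds the reciprocal mass of block \<open>i\<close> in any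
  interval with endpoint ratio \<open>A\<^sup>2\<close>; \<open>G 0 = 1\<close> covers permutations
  for which no confinement is available. By \<open>S1\<close>, a product lacking the factor of one
  position is at most the full product.\<close>

locale prime_blocks =
  fixes k t :: nat and P :: "nat \<Rightarrow> nat set" and A :: real and G :: "nat \<Rightarrow> real"
  assumes finP: "i < k \<Longrightarrow> finite (P i)"
    and primeP: "i < k \<Longrightarrow> p \<in> P i \<Longrightarrow> prime p"
    and disjP: "i < k \<Longrightarrow> j < k \<Longrightarrow> p \<in> P i \<Longrightarrow> p \<in> P j \<Longrightarrow> i = j"
    and A1: "A \<ge> 1"
    and G0: "G 0 = 1" and Gnonneg: "\<And>i. G i \<ge> 0"
    and GSuc: "i < k \<Longrightarrow> z > 0 \<Longrightarrow>
       (\<Sum>p | p \<in> P i \<and> z \<le> real p \<and> real p \<le> A\<^sup>2 * z. 1 / real p) \<le> G (Suc i)"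
    and S1: "i < k \<Longrightarrow> (\<Sum>p\<in>P i. 1 / real p) \<ge> 1"
begin

text \<open>A tuple \<open>r\<close> in \<open>T\<close> has \<open>r (i, j)\<close> as its \<open>j\<close>-th prime from block \<open>i\<close>; the elements of \<open>D\<close> index
  a pair of such tuples, the Boolean component selecting the tuple.\<close>

definition J :: "(nat \<times> nat) set" where "J = {..<k} \<times> {..<t}"
definition D :: "((nat \<times> nat) \<times> bool) set" where "D = J \<times> UNIV"
definition D0 :: "((nat \<times> nat) \<times> bool) set" where "D0 = J \<times> {False}"
definition blk :: "(nat \<times> nat) \<times> bool \<Rightarrow> nat" where "blk d = fst (fst d)"
definition T :: "(nat \<times> nat \<Rightarrow> nat) set" where "T = PiE J (\<lambda>x. P (fst x))"
definition val :: "(nat \<times> nat \<Rightarrow> nat) \<Rightarrow> nat" where "val r = (\<Prod>x\<in>J. r x)"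
definition S :: "nat \<Rightarrow> real" where "S i = (\<Sum>p\<in>P i. 1 / real p)"

text \<open>The pairing is that of a common large prime in the first and third components, which is
  the source of the proximity condition.\<close>

definition quads :: "((nat \<times> nat \<Rightarrow> nat) \<times> (nat \<times> nat \<Rightarrow> nat) \<times> (nat \<times> nat \<Rightarrow> nat) \<times> (nat \<times> nat \<Rightarrow> nat)) set"
  where "quads = {(r1, r2, r3, r4). r1 \<in> T \<and> r2 \<in> T \<and> r3 \<in> T \<and> r4 \<in> T \<and>
     val r1 * val r2 = val r3 * val r4 \<and> near A (val r1) (val r3)}"

lemma finite_J [simp]: "finite J" and finite_D [simp]: "finite D" and D0_subset: "D0 \<subseteq> D"
  and finite_D0 [simp]: "finite D0"
  by (auto simp: J_def D_def D0_def)

lemma blk_less: "d \<in> D \<Longrightarrow> blk d < k" "d \<in> D0 \<Longrightarrow> blk d < k" "x \<in> J \<Longrightarrow> fst x < k"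
  by (auto simp: D_def D0_def J_def blk_def)

lemma finite_T: "finite T" unfolding T_def using finP blk_less by (intro finite_PiE) auto

lemma val_pos: "r \<in> T \<Longrightarrow> val r > 0"
proof -
  assume r: "r \<in> T"
  have "r x > 0" if "x \<in> J" for x
  proof -
    have "r x \<in> P (fst x)" using r that unfolding T_def by (rule PiE_mem)
    thus ?thesis using primeP[OF blk_less(3)[OF that]] prime_gt_0_nat by blast
  qed
  thus "val r > 0" unfolding val_def by (intro prod_pos) auto
qed

lemma finite_quads: "finite quads"
  by (rule finite_subset[of _ "T \<times> T \<times> T \<times> T"]) (auto simp: quads_def finite_T)

lemma sum_T: "(\<Sum>r\<in>T. 1 / real (val r)) = (\<Prod>i<k. S i ^ t)"
proof -
  have "(\<Sum>r\<in>T. 1 / real (val r)) = (\<Sum>r\<in>T. \<Prod>x\<in>J. 1 / real (r x))"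
    unfolding val_def by (simp add: prod_dividef)
  also have "\<dots> = (\<Prod>x\<in>J. S (fst x))"
    unfolding T_def S_def using finP blk_less by (subst prod_sum_PiE) auto
  also have "\<dots> = (\<Prod>i<k. S i ^ t)"
    unfolding J_def by (subst prod.Sigma[symmetric, where ?g = "\<lambda>i j. S i", unfolded case_prod_unfold]) auto
  finally show ?thesis .
qed

lemma prod_D: "prod f D = (\<Prod>x\<in>J. f (x, False)) * (\<Prod>x\<in>J. f (x, True))"
  for f :: "_ \<Rightarrow> 'z::comm_monoid_mult"
proof -
  have "prod f D = (\<Prod>x\<in>J. \<Prod>b\<in>UNIV. f (x, b))"
    unfolding D_def by (subst prod.Sigma) (auto simp: case_prod_unfold)
  also have "\<dots> = (\<Prod>x\<in>J. f (x, False)) * (\<Prod>x\<in>J. f (x, True))"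
    by (simp add: UNIV_bool prod.distrib mult.commute)
  finally show ?thesis .
qed

lemma prod_D0: "prod f D0 = (\<Prod>x\<in>J. f (x, False))"
proof -
  have "D0 = (\<lambda>x. (x, False)) ` J" by (auto simp: D0_def)
  thus ?thesis by (simp add: prod.reindex inj_on_def)
qed

lemma prod_S_D: "(\<Prod>d\<in>D. S (blk d)) = (\<Prod>i<k. S i ^ (2 * t))"
proof -
  have "(\<Prod>x\<in>J. S (fst x)) = (\<Prod>i<k. S i ^ t)"
    unfolding J_def by (subst prod.Sigma[symmetric, where ?g = "\<lambda>i j. S i", unfolded case_prod_unfold]) auto
  thus ?thesis unfolding prod_D
    by (simp add: blk_def power_mult mult_2 power_add prod.distrib)
qed

definition perms :: "nat \<Rightarrow> ((nat \<times> nat) \<times> bool \<Rightarrow> (nat \<times> nat) \<times> bool) set" where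
  "perms m = {\<sigma>. \<sigma> permutes D \<and> (\<forall>d\<in>D. blk (\<sigma> d) = blk d) \<and>
     (\<forall>d\<in>D. blk d \<ge> m \<longrightarrow> snd (\<sigma> d) = snd d)}"

lemma finite_perms: "finite (perms m)"
  by (rule finite_subset[OF _ finite_permutations[OF finite_D]]) (auto simp: perms_def)

text \<open>In each of the \<open>m\<close> mixed blocks all \<open>2 * t\<close> positions may be
  interchanged; in the others the two groups of \<open>t\<close> positions are permuted
  separately.\<close>

lemma card_perms:
  assumes "m \<le> k"
  shows "card (perms m) \<le> fact (2 * t) ^ m * (fact t)\<^sup>2 ^ (k - m)"
proof -
  \<comment> \<open>The constant \<open>False\<close> merges the two tuples into one fibre in every
    block below \<open>m\<close>.\<close>
  define lab where "lab d = (blk d, if blk d < m then False else snd d)" for d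
  define C where "C = {..<m} \<times> {False} \<union> {m..<k} \<times> (UNIV :: bool set)"
  have "card (perms m) \<le> card {\<sigma>. \<sigma> permutes D \<and> (\<forall>d\<in>D. lab (\<sigma> d) = lab d)}"
    by (rule card_mono)
       (auto simp: perms_def lab_def intro: finite_subset[OF _ finite_permutations[OF finite_D]])
  also have "\<dots> \<le> (\<Prod>c\<in>C. fact (card {d\<in>D. lab d = c}))"
    by (rule card_label_preserving_permutations) (auto simp: C_def lab_def blk_less(1))
  also have "\<dots> = (\<Prod>c\<in>{..<m} \<times> {False}. fact (card {d\<in>D. lab d = c})) *
                   (\<Prod>c\<in>{m..<k} \<times> UNIV. fact (card {d\<in>D. lab d = c}))"
    unfolding C_def by (rule prod.union_disjoint) auto
  also have "(\<Prod>c\<in>{..<m} \<times> {False}. fact (card {d\<in>D. lab d = c})) = (\<Prod>c\<in>{..<m} \<times> {False}. fact (2 * t))"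
  proof (intro prod.cong refl arg_cong[of _ _ fact])
    fix c :: "nat \<times> bool" assume c: "c \<in> {..<m} \<times> {False}"
    hence "{d\<in>D. lab d = c} = ({fst c} \<times> {..<t}) \<times> UNIV"
      using assms by (auto simp: D_def J_def lab_def blk_def split: if_splits)
    thus "card {d\<in>D. lab d = c} = 2 * t" by (simp add: card_cartesian_product)
  qed
  also have "(\<Prod>c\<in>{m..<k} \<times> UNIV. fact (card {d\<in>D. lab d = c})) = (\<Prod>c\<in>{m..<k} \<times> (UNIV :: bool set). fact t)"
  proof (intro prod.cong refl arg_cong[of _ _ fact])
    fix c :: "nat \<times> bool" assume c: "c \<in> {m..<k} \<times> UNIV"
    hence "{d\<in>D. lab d = c} = ({fst c} \<times> {..<t}) \<times> {snd c}"
      by (auto simp: D_def J_def lab_def blk_def split: if_splits)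
    thus "card {d\<in>D. lab d = c} = t" by (simp add: card_cartesian_product)
  qed
  finally show ?thesis by (simp add: card_cartesian_product power_mult power2_eq_square power_mult_distrib
      flip: power_add)
qed

text \<open>The positions of the first tuple in block \<open>i\<close> form a finite set that is
  covered by its own image, so \<open>\<sigma>\<close> maps it onto itself and hence preserves its
  complement in the block.\<close>

lemma block_stable:
  assumes s: "\<sigma> permutes D" "\<And>d. d \<in> D \<Longrightarrow> blk (\<sigma> d) = blk d"
    and cov: "\<And>d. d \<in> D0 \<Longrightarrow> blk d = i \<Longrightarrow> d \<in> \<sigma> ` D0" and d: "d \<in> D" "blk d = i"
  shows "snd (\<sigma> d) = snd d"
proof -
  let ?B = "{d\<in>D0. blk d = i}"
  have sub: "?B \<subseteq> \<sigma> ` ?B"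
  proof
    fix d assume d: "d \<in> ?B"
    then obtain e where e: "e \<in> D0" "d = \<sigma> e" using cov by blast
    hence "blk e = i" using s(2)[of e] d D0_subset by auto
    thus "d \<in> \<sigma> ` ?B" using e by auto
  qed
  have "card (\<sigma> ` ?B) = card ?B"
    using permutes_inj_on[OF s(1)] by (intro card_image)
  hence eq: "\<sigma> ` ?B = ?B"
    using sub by (intro card_subset_eq[symmetric]) auto
  have D0iff: "e \<in> D0 \<longleftrightarrow> \<not> snd e" if "e \<in> D" for e
    using that by (auto simp: D_def D0_def)
  have sD: "\<sigma> d \<in> D" using d s by (simp add: permutes_in_image)
  have "\<sigma> d \<in> ?B \<longleftrightarrow> d \<in> ?B"
  proof
    assume "\<sigma> d \<in> ?B"
    then obtain e where "e \<in> ?B" "\<sigma> e = \<sigma> d" using eq by (metis (lifting) imageE)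
    thus "d \<in> ?B" using permutes_inj[OF s(1)] by (auto dest: injD)
  qed (use eq in blast)
  thus ?thesis using D0iff[OF sD] D0iff[OF d(1)] s(2)[OF d(1)] d(2) by auto
qed

text \<open>\<open>r1\<close>, \<open>r2\<close> and \<open>r3\<close>, \<open>r4\<close> are each
  joined to a family over \<open>D\<close>. The products of the two families agree, and disjointness
  of the prime sets forces the resulting permutation to respect the blocks.\<close>

lemma quad_permutation:
  assumes q: "(r1, r2, r3, r4) \<in> quads"
  defines "R \<equiv> (\<lambda>d\<in>D. if snd d then r2 (fst d) else r1 (fst d))"
  obtains \<sigma> where "\<sigma> permutes D" "\<And>d. d \<in> D \<Longrightarrow> blk (\<sigma> d) = blk d"
    "\<And>x. x \<in> J \<Longrightarrow> r3 x = R (\<sigma> (x, False))" "\<And>x. x \<in> J \<Longrightarrow> r4 x = R (\<sigma> (x, True))"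
proof -
  define R' where "R' = (\<lambda>d\<in>D. if snd d then r4 (fst d) else r3 (fst d))"
  have rT: "r1 \<in> T" "r2 \<in> T" "r3 \<in> T" "r4 \<in> T" and vv: "val r1 * val r2 = val r3 * val r4"
    using q by (auto simp: quads_def)
  have mem: "R d \<in> P (blk d)" "R' d \<in> P (blk d)" if "d \<in> D" for d
    using rT that unfolding R_def R'_def T_def by (auto simp: D_def blk_def dest!: PiE_mem)
  have DJ: "(x, b) \<in> D \<longleftrightarrow> x \<in> J" for x b by (simp add: D_def)
  have "prod R' D = prod R D"
    using vv unfolding prod_D by (simp add: R_def R'_def DJ val_def mult_ac)
  moreover have "prime (R d)" "prime (R' d)" if "d \<in> D" for d
    using mem[OF that] primeP[OF blk_less(1)[OF that]] by blast+
  ultimately obtain \<sigma> where s: "\<sigma> permutes D" "\<forall>d\<in>D. R' d = R (\<sigma> d)"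
    using equal_prime_products_imp_permutes[OF finite_D] by metis
  show ?thesis
  proof (rule that[OF s(1)])
    fix d assume d: "d \<in> D"
    have sd: "\<sigma> d \<in> D" using d s by (simp add: permutes_in_image)
    have "R' d \<in> P (blk d)" "R' d \<in> P (blk (\<sigma> d))"
      using mem(2)[OF d] mem(1)[OF sd] s(2) d by auto
    thus "blk (\<sigma> d) = blk d" using disjP blk_less(1) d sd by metis
  next
    fix x assume x: "x \<in> J"
    have "R' (x, False) = r3 x" "R' (x, True) = r4 x"
      using x by (simp_all add: R'_def DJ)
    moreover have "R' (x, b) = R (\<sigma> (x, b))" for b
      using s(2) x DJ by blast
    ultimately show "r3 x = R (\<sigma> (x, False))" "r4 x = R (\<sigma> (x, True))" by metis+
  qed
qed

text \<open>A quadruple is encoded by its first two tuples \<open>R\<close>, a permutation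
  \<open>\<sigma>\<close> and the number \<open>m\<close> of blocks up to the last one where
  \<open>\<sigma>\<close> mixes the tuples. The number of \<open>\<sigma>\<close> is bounded by
  \<open>card_perms\<close>, and for \<open>m > 0\<close> an unhit position in block
  \<open>m - 1\<close> gives the factor \<open>G m\<close>.\<close>

theorem log_energy_le:
  "(\<Sum>(r1, r2, r3, r4)\<in>quads. 1 / (real (val r1) * real (val r2)))
     \<le> (\<Sum>m\<le>k. fact (2 * t) ^ m * (fact t)\<^sup>2 ^ (k - m) * G m) * (\<Prod>i<k. S i ^ (2 * t))"
proof -
  let ?Q = "\<lambda>d. P (blk d)"
  define cond where "cond \<sigma> R \<longleftrightarrow> near A (\<Prod>d\<in>D0. R d) (\<Prod>d\<in>D0. R (\<sigma> d))"
    for \<sigma> :: "(nat \<times> nat) \<times> bool \<Rightarrow> (nat \<times> nat) \<times> bool" and R :: "(nat \<times> nat) \<times> bool \<Rightarrow> nat"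
  \<comment> \<open>For \<open>m > 0\<close> the unhit position shows that block
    \<open>m - 1\<close> is really mixed.\<close>
  define G' where "G' m = {\<sigma>\<in>perms m. m = 0 \<or> (\<exists>d0\<in>D0. blk d0 = m - 1 \<and> d0 \<notin> \<sigma> ` D0)}" for m
  define RR where "RR \<sigma> = {R. R \<in> PiE D ?Q \<and> cond \<sigma> R}" for \<sigma>
  define I where "I = (SIGMA m:{..k}. SIGMA \<sigma>:G' m. RR \<sigma>)"
  define dec where "dec = (\<lambda>(m::nat, \<sigma>, R).
     ((\<lambda>x\<in>J. R (x, False)) :: nat \<times> nat \<Rightarrow> nat, (\<lambda>x\<in>J. R (x, True)) :: nat \<times> nat \<Rightarrow> nat,
      (\<lambda>x\<in>J. R (\<sigma> (x, False))) :: nat \<times> nat \<Rightarrow> nat, (\<lambda>x\<in>J. R (\<sigma> (x, True))) :: nat \<times> nat \<Rightarrow> nat))"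
  define W where "W R = (\<Prod>d\<in>D. 1 / real (R d))" for R :: "(nat \<times> nat) \<times> bool \<Rightarrow> nat"
  have finPi: "finite (PiE D ?Q)" using finP blk_less by (intro finite_PiE) auto
  have finRR: "finite (RR \<sigma>)" for \<sigma> using finPi by (simp add: RR_def)
  have finG': "finite (G' m)" for m using finite_perms by (simp add: G'_def)
  have finI: "finite I" unfolding I_def using finRR finG' by (intro finite_SigmaI) auto
  have W0: "W R \<ge> 0" for R unfolding W_def by (intro prod_nonneg) auto
  have S_ge_1: "S i \<ge> 1" if "i < k" for i using S1[OF that] by (simp add: S_def)
  have DJ: "(x, b) \<in> D \<longleftrightarrow> x \<in> J" for x b by (simp add: D_def)

  \<comment> \<open>It suffices that \<open>dec\<close> reaches every quadruple from a triple of
    equal weight; repetitions are harmless because all weights are nonnegative.\<close>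
  have "(\<Sum>(r1, r2, r3, r4)\<in>quads. 1 / (real (val r1) * real (val r2))) \<le> (\<Sum>(m, \<sigma>, R)\<in>I. W R)"
  proof (rule sum_le_included[where i = dec])
    show "finite quads" "finite I" by (fact finite_quads finI)+
    show "\<forall>y\<in>I. 0 \<le> (case y of (m, \<sigma>, R) \<Rightarrow> W R)" using W0 by auto
    show "\<forall>x\<in>quads. \<exists>y\<in>I. dec y = x \<and>
       (case x of (r1, r2, r3, r4) \<Rightarrow> 1 / (real (val r1) * real (val r2))) \<le> (case y of (m, \<sigma>, R) \<Rightarrow> W R)"
    proof (clarify)
      fix r1 r2 r3 r4 assume q: "(r1, r2, r3, r4) \<in> quads"
      define R where "R = (\<lambda>d\<in>D. if snd d then r2 (fst d) else r1 (fst d))"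
      obtain \<sigma> where s: "\<sigma> permutes D" "\<And>d. d \<in> D \<Longrightarrow> blk (\<sigma> d) = blk d"
        "\<And>x. x \<in> J \<Longrightarrow> r3 x = R (\<sigma> (x, False))" "\<And>x. x \<in> J \<Longrightarrow> r4 x = R (\<sigma> (x, True))"
        using quad_permutation[OF q] unfolding R_def by blast
      have rT: "r1 \<in> T" "r2 \<in> T" "r3 \<in> T" "r4 \<in> T" and nr: "near A (val r1) (val r3)"
        using q by (auto simp: quads_def)
      have ext: "r x = undefined" if "r \<in> T" "x \<notin> J" for r x
        using that unfolding T_def by (rule PiE_arb)
      have "dec (m, \<sigma>, R) = (r1, r2, r3, r4)" for m
      proof -
        have "(\<lambda>x\<in>J. R (x, False)) = r1" "(\<lambda>x\<in>J. R (x, True)) = r2"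
          "(\<lambda>x\<in>J. R (\<sigma> (x, False))) = r3" "(\<lambda>x\<in>J. R (\<sigma> (x, True))) = r4"
          using s(3,4) ext[OF rT(1)] ext[OF rT(2)] ext[OF rT(3)] ext[OF rT(4)]
          by (auto simp del: split_paired_All split_paired_all simp: restrict_def R_def DJ intro!: ext)
        thus ?thesis by (simp add: dec_def)
      qed
      have RP: "R \<in> PiE D ?Q"
        using rT unfolding R_def T_def by (auto simp: D_def blk_def dest!: PiE_mem)
      have "(\<Prod>d\<in>D0. R d) = val r1" "(\<Prod>d\<in>D0. R (\<sigma> d)) = val r3"
        unfolding prod_D0 val_def by (auto intro!: prod.cong simp: R_def DJ s(3)[unfolded R_def])
      hence RRR: "R \<in> RR \<sigma>" using RP nr by (simp add: RR_def cond_def)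
      have WR: "1 / (real (val r1) * real (val r2)) = W R"
        unfolding W_def prod_D val_def by (simp add: R_def DJ prod_dividef)
      \<comment> \<open>\<open>bad m\<close> says that from block \<open>m\<close> on no position of
        the first tuple is missed; the least such \<open>m\<close> is therefore 0 or one more than
        the index of the last block with a missed position.\<close>
      define bad where "bad m \<longleftrightarrow> (\<forall>d\<in>D0. blk d \<ge> m \<longrightarrow> d \<in> \<sigma> ` D0)" for m
      define m where "m = (LEAST m. bad m)"
      have badk: "bad k" using blk_less(2) unfolding bad_def by force
      have badm: "bad m" unfolding m_def by (rule LeastI[of bad, OF badk])
      have mk: "m \<le> k" unfolding m_def by (rule Least_le[of bad, OF badk])
      have "\<sigma> \<in> perms m"
        unfolding perms_def
      proof (intro CollectI conjI ballI impI)
        fix d assume d: "d \<in> D" "m \<le> blk d"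
        show "snd (\<sigma> d) = snd d"
          by (rule block_stable[where i = "blk d", OF s(1)]) (use s(2) badm d in \<open>auto simp: bad_def\<close>)
      qed (use s in auto)
      moreover have "m = 0 \<or> (\<exists>d0\<in>D0. blk d0 = m - 1 \<and> d0 \<notin> \<sigma> ` D0)"
      proof (cases "m = 0")
        case False
        hence "\<not> bad (m - 1)" using not_less_Least[of "m - 1" bad] unfolding m_def by simp
        then obtain d0 where d0: "d0 \<in> D0" "blk d0 \<ge> m - 1" "d0 \<notin> \<sigma> ` D0" unfolding bad_def by blast
        moreover have "\<not> blk d0 \<ge> m" using badm d0 unfolding bad_def by blast
        ultimately show ?thesis by (metis Suc_pred' False bot_nat_0.not_eq_extremum le_antisym not_less_eq_eq)
      qed simp
      ultimately have "(m, \<sigma>, R) \<in> I" using mk RRR unfolding I_def G'_def by auto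
      thus "\<exists>y\<in>I. dec y = (r1, r2, r3, r4) \<and> 1 / (real (val r1) * real (val r2)) \<le> (case y of (m, \<sigma>, R) \<Rightarrow> W R)"
        using \<open>dec (m, \<sigma>, R) = _\<close> WR by (intro bexI[of _ "(m, \<sigma>, R)"]) auto
    qed
  qed
  also have "\<dots> = (\<Sum>m\<le>k. \<Sum>\<sigma>\<in>G' m. \<Sum>R\<in>RR \<sigma>. W R)"
    unfolding I_def using finRR finG' by (subst sum.Sigma) (auto simp: sum.Sigma case_prod_unfold)
  also have "\<dots> \<le> (\<Sum>m\<le>k. \<Sum>\<sigma>\<in>G' m. G m * (\<Prod>d\<in>D. S (blk d)))"
  proof (intro sum_mono)
    fix m \<sigma> assume m: "m \<in> {..k}" and sg: "\<sigma> \<in> G' m"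
    show "(\<Sum>R\<in>RR \<sigma>. W R) \<le> G m * (\<Prod>d\<in>D. S (blk d))"
    proof (cases "m = 0")
      case True
      have "(\<Sum>R\<in>RR \<sigma>. W R) \<le> (\<Sum>R\<in>PiE D ?Q. W R)"
        using finPi W0 by (intro sum_mono2) (auto simp: RR_def)
      also have "\<dots> = (\<Prod>d\<in>D. S (blk d))"
        unfolding W_def S_def using finP blk_less by (subst prod_sum_PiE) auto
      finally show ?thesis using True G0 by simp
    next
      case False
      then obtain d0 where d0: "d0 \<in> D0" "blk d0 = m - 1" "d0 \<notin> \<sigma> ` D0"
        using sg unfolding G'_def by auto
      have d0D: "d0 \<in> D" using d0 D0_subset by auto
      have "(\<Sum>R\<in>RR \<sigma>. W R) \<le> G m * (\<Prod>d\<in>D - {d0}. \<Sum>p\<in>?Q d. 1 / real p)"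
        unfolding RR_def cond_def W_def
      proof (rule near_permuted_sum_le[OF finite_D])
        show "\<sigma> permutes D" using sg by (auto simp: G'_def perms_def)
        fix z :: real assume "z > 0"
        thus "(\<Sum>p | p \<in> P (blk d0) \<and> z \<le> real p \<and> real p \<le> A\<^sup>2 * z. 1 / real p) \<le> G m"
          using GSuc[of "m - 1" z] blk_less(1)[OF d0D] False d0(2) by simp
      next
        fix d p assume "d \<in> D" "p \<in> ?Q d"
        thus "p > 0" using primeP[OF blk_less(1), of d p] prime_gt_0_nat by blast
      qed (use d0 D0_subset A1 finP blk_less(1) in auto)
      \<comment> \<open>The factor of \<open>d0\<close>, replaced by \<open>G m\<close>, is restored
        at no cost because it is at least 1.\<close>
      also have "\<dots> \<le> G m * ((\<Prod>d\<in>D - {d0}. S (blk d)) * S (blk d0))"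
      proof (intro mult_left_mono Gnonneg)
        have "(\<Prod>d\<in>D - {d0}. S (blk d)) * 1 \<le> (\<Prod>d\<in>D - {d0}. S (blk d)) * S (blk d0)"
          using S_ge_1 blk_less(1) d0D by (intro mult_left_mono prod_nonneg) (auto simp: S_def intro: sum_nonneg)
        thus "(\<Prod>d\<in>D - {d0}. \<Sum>p\<in>?Q d. 1 / real p) \<le> (\<Prod>d\<in>D - {d0}. S (blk d)) * S (blk d0)"
          by (simp add: S_def)
      qed
      also have "(\<Prod>d\<in>D - {d0}. S (blk d)) * S (blk d0) = (\<Prod>d\<in>D. S (blk d))"
        using d0D by (simp add: prod.remove[of D d0] mult.commute)
      finally show ?thesis .
    qed
  qed
  also have "\<dots> = (\<Sum>m\<le>k. real (card (G' m)) * (G m * (\<Prod>d\<in>D. S (blk d))))" by simp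
  also have "\<dots> \<le> (\<Sum>m\<le>k. fact (2 * t) ^ m * (fact t)\<^sup>2 ^ (k - m) * (G m * (\<Prod>d\<in>D. S (blk d))))"
  proof (intro sum_mono mult_right_mono)
    fix m assume m: "m \<in> {..k}"
    have "card (G' m) \<le> card (perms m)"
      unfolding G'_def by (intro card_mono finite_perms) auto
    also have "\<dots> \<le> fact (2 * t) ^ m * (fact t)\<^sup>2 ^ (k - m)" using card_perms m by simp
    finally have "real (card (G' m)) \<le> real (fact (2 * t) ^ m * (fact t)\<^sup>2 ^ (k - m))"
      by (simp only: of_nat_le_iff)
    thus "real (card (G' m)) \<le> fact (2 * t) ^ m * (fact t)\<^sup>2 ^ (k - m)" by simp
    show "0 \<le> G m * (\<Prod>d\<in>D. S (blk d))"
      by (intro mult_nonneg_nonneg Gnonneg prod_nonneg) (auto simp: S_def intro: sum_nonneg)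
  qed
  also have "\<dots> = (\<Sum>m\<le>k. fact (2 * t) ^ m * (fact t)\<^sup>2 ^ (k - m) * G m) * (\<Prod>i<k. S i ^ (2 * t))"
    unfolding prod_S_D by (simp add: sum_distrib_right mult.assoc)
  finally show ?thesis .
qed

end

section \<open>A weight of small energy\<close>

lemma pos_upto_altdef: "pos_upto N = {1..nat \<lfloor>N\<rfloor>}"
  by (auto simp: pos_upto_def le_nat_floor) linarith

lemma finite_pos_upto [simp]: "finite (pos_upto N)"
  by (simp add: pos_upto_altdef)

lemma weight_norm_card:
  assumes "finite TT" "\<And>\<tau>. \<tau> \<in> TT \<Longrightarrow> v \<tau> \<in> pos_upto N"
  shows "weight_norm N (\<lambda>m. real (card {\<tau>\<in>TT. v \<tau> = m})) = real (card TT)"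
proof -
  have "weight_norm N (\<lambda>m. real (card {\<tau>\<in>TT. v \<tau> = m})) = (\<Sum>m\<in>pos_upto N. \<Sum>\<tau> | \<tau> \<in> TT \<and> v \<tau> = m. 1)"
    by (simp add: weight_norm_def)
  also have "\<dots> = (\<Sum>\<tau>\<in>TT. 1)"
    using assms by (intro sum.group) auto
  finally show ?thesis by simp
qed

text \<open>The energy of a representation function counts quadruples of representations, here only
  those whose values are at most \<open>N\<close>.\<close>

lemma weighted_energy_card_le:
  fixes v :: "'t \<Rightarrow> nat"
  assumes "finite TT"
  shows "weighted_energy N (\<lambda>m. real (card {\<tau>\<in>TT. v \<tau> = m})) \<le>
    real (card {(\<tau>1, \<tau>2, \<tau>3, \<tau>4). \<tau>1 \<in> TT \<and> \<tau>2 \<in> TT \<and> \<tau>3 \<in> TT \<and> \<tau>4 \<in> TT \<and> v \<tau>1 * v \<tau>2 = v \<tau>3 * v \<tau>4})"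
    (is "_ \<le> real (card ?Z)")
proof -
  let ?f = "\<lambda>m. {\<tau>\<in>TT. v \<tau> = m}"
  let ?M = "{(m1, m2, n1, n2). m1 \<in> pos_upto N \<and> m2 \<in> pos_upto N \<and> n1 \<in> pos_upto N \<and>
         n2 \<in> pos_upto N \<and> m1 * m2 = n1 * n2}"
  let ?F = "\<lambda>(m1, m2, n1, n2). ?f m1 \<times> ?f m2 \<times> ?f n1 \<times> ?f n2"
  have finM: "finite ?M"
    by (rule finite_subset[of _ "pos_upto N \<times> pos_upto N \<times> pos_upto N \<times> pos_upto N"]) auto
  have finZ: "finite ?Z"
    by (rule finite_subset[of _ "TT \<times> TT \<times> TT \<times> TT"]) (use assms in auto)
  have "weighted_energy N (\<lambda>m. real (card (?f m))) = (\<Sum>m\<in>?M. real (card (?F m)))"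
    unfolding weighted_energy_def by (intro sum.cong refl) (auto simp: card_cartesian_product)
  also have "\<dots> = real (card (SIGMA m:?M. ?F m))"
    using assms finM by (subst card_SigmaI) auto
  also have "\<dots> \<le> real (card ?Z)"
  proof (rule of_nat_mono, rule card_inj_on_le[of snd])
    show "inj_on snd (SIGMA m:?M. ?F m)"
      by (rule inj_on_inverseI[where g = "\<lambda>(\<tau>1, \<tau>2, \<tau>3, \<tau>4). ((v \<tau>1, v \<tau>2, v \<tau>3, v \<tau>4), (\<tau>1, \<tau>2, \<tau>3, \<tau>4))"])
         clarsimp
    show "snd ` (SIGMA m:?M. ?F m) \<subseteq> ?Z" by clarsimp
  qed (rule finZ)
  finally show ?thesis .
qed

lemma min_energy_le:
  assumes "admissible_weight N w"
  shows "min_energy N \<le> N\<^sup>2 * weighted_energy N w / weight_norm N w ^ 4"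
  unfolding min_energy_def
proof (rule cINF_lower)
  have "0 \<le> N\<^sup>2 * weighted_energy N w / weight_norm N w ^ 4" if "admissible_weight N w" for w
  proof -
    have "weighted_energy N w \<ge> 0"
      unfolding weighted_energy_def using that
      by (intro sum_nonneg) (auto simp: admissible_weight_def)
    thus ?thesis by simp
  qed
  thus "bdd_below ((\<lambda>w. N\<^sup>2 * weighted_energy N w / weight_norm N w ^ 4) ` {w. admissible_weight N w})"
    by (intro bdd_belowI[of _ 0]) auto
qed (use assms in simp)

text \<open>The value \<open>A = exp 9\<close> is chosen so that \<open>ln A\<close> exceeds the error \<open>8\<close> of Mertens' theorem by \<open>1\<close>.\<close>

lemma card_primes_interval:
  fixes y l M :: real
  assumes "A = exp 9" "y / A \<ge> 1" "l > 0" "ln (y / A) \<ge> l" "ln y \<le> M"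
  defines "Q \<equiv> {q. prime q \<and> y / A < real q \<and> real q \<le> y}"
  shows "finite Q" "real (card Q) \<ge> y / (A * M)" "real (card Q) \<le> 17 * y / l"
proof -
  have A: "A > 1" "ln A = 9" using assms(1) by auto
  have y: "y > 0" "y / A > 0" "y / A \<le> y" "y \<ge> 1"
  proof -
    show "y / A > 0" using assms(2) by linarith
    thus y0: "y > 0" using A by (simp add: zero_less_divide_iff)
    show "y / A \<le> y" using y0 A by (simp add: field_simps)
    thus "y \<ge> 1" using assms(2) by linarith
  qed
  show fin: "finite Q" unfolding Q_def by (rule finite_subset[OF _ finite_primes_real_le[of y]]) auto
  have ln: "ln (y / (y / A)) = 9" using y A by simp
  have Qb: "ln (real q) \<le> M" "ln (real q) \<ge> l" "real q > y / A" "real q \<le> y" "real q > 0" if "q \<in> Q" for q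
  proof -
    show q: "real q > y / A" "real q \<le> y" using that by (auto simp: Q_def)
    show q0: "real q > 0" using q y by linarith
    have "ln (real q) \<le> ln y" using q q0 by (intro ln_mono) auto
    thus "ln (real q) \<le> M" using assms by linarith
    have "ln (y / A) \<le> ln (real q)" using q y by (intro ln_mono) auto
    thus "ln (real q) \<ge> l" using assms by linarith
  qed
  have "ln (y / A) \<le> ln y" using y by (intro ln_mono) auto
  hence M: "M > 0" using assms by linarith
  have "1 \<le> (\<Sum>q\<in>Q. ln (real q) / real q)"
    using sum_ln_prime_div_half_open(1)[of "y / A" y] assms(2) y ln unfolding Q_def by simp
  also have "\<dots> \<le> (\<Sum>q\<in>Q. M / (y / A))"
    by (intro sum_mono frac_le) (use Qb M y in \<open>auto simp: less_imp_le\<close>)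
  finally have "1 \<le> real (card Q) * (M / (y / A))" by simp
  thus "real (card Q) \<ge> y / (A * M)" using y A M by (simp add: field_simps)
  have "real (card Q) * (l / y) = (\<Sum>q\<in>Q. l / y)" by simp
  also have "\<dots> \<le> (\<Sum>q\<in>Q. ln (real q) / real q)"
  proof (intro sum_mono frac_le)
    fix q assume q: "q \<in> Q"
    show "l \<le> ln (real q)" "0 < real q" "real q \<le> y" using Qb[OF q] by auto
    show "0 \<le> ln (real q)" using Qb[OF q] assms by linarith
  qed
  \<comment> \<open>17 = ln A + 8.\<close>
  also have "\<dots> \<le> 17"
    using sum_ln_prime_div_half_open(2)[of "y / A" y] assms(2) y ln unfolding Q_def by simp
  finally show "real (card Q) \<le> 17 * y / l" using y assms by (simp add: field_simps)
qed

text \<open>Block products are at most the square root of \<open>N\<close>, which leaves room for a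
  large top prime. \<open>L \<ge> 36\<close> ensures \<open>L / 2 - 9 \<ge> L / 4\<close>, so every
  top prime exceeds \<open>exp (L / 4)\<close> and differs from all block primes.\<close>

locale prime_blocks_level = prime_blocks +
  fixes N L :: real
  assumes A_def: "A = exp 9" and N: "N = exp L" and L36: "L \<ge> 36"
    and small: "i < k \<Longrightarrow> p \<in> P i \<Longrightarrow> real p \<le> exp (L / 4)"
    and val_le: "r \<in> T \<Longrightarrow> real (val r) \<le> exp (L / 2)"
begin

text \<open>The top primes completing \<open>n\<close>: the product of \<open>n\<close> with any of
  them lies between \<open>N / A\<close> and \<open>N\<close>.\<close>

definition Q :: "nat \<Rightarrow> nat set" where "Q n = {q. prime q \<and> N / real n / A < real q \<and> real q \<le> N / real n}"
definition TT :: "((nat \<times> nat \<Rightarrow> nat) \<times> nat) set" where "TT = (SIGMA r:T. Q (val r))"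
definition tv :: "(nat \<times> nat \<Rightarrow> nat) \<times> nat \<Rightarrow> nat" where "tv \<tau> = val (fst \<tau>) * snd \<tau>"
definition weight :: "nat \<Rightarrow> real" where "weight m = real (card {\<tau>\<in>TT. tv \<tau> = m})"

lemma Q_bounds:
  assumes r: "r \<in> T"
  shows "finite (Q (val r))" "real (card (Q (val r))) \<ge> N / (A * L) * (1 / real (val r))"
    "real (card (Q (val r))) \<le> 68 * N / L * (1 / real (val r))"
    "q \<in> Q (val r) \<Longrightarrow> real q > exp (L / 4)"
proof -
  define y where "y = N / real (val r)"
  have v: "real (val r) > 0" "real (val r) \<ge> 1" using val_pos[OF r] by auto
  have yL: "ln y = L - ln (real (val r))" "y > 0" unfolding y_def N using v by (auto simp: ln_div)
  have "ln (real (val r)) \<le> L / 2" using val_le[OF r] v by (metis ln_exp ln_mono)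
  moreover have "ln (real (val r)) \<ge> 0" using v by simp
  ultimately have ly: "L / 2 \<le> ln y" "ln y \<le> L" using yL by auto
  have A: "A > 0" using A_def by simp
  have lyA: "ln (y / A) = ln y - 9" using yL A by (simp add: ln_div A_def)
  hence lyA': "ln (y / A) \<ge> L / 4" using ly L36 by linarith
  have yA: "y / A \<ge> exp (L / 4)" using lyA' yL A by (metis divide_pos_pos exp_le_cancel_iff exp_ln)
  have "exp (L / 4) \<ge> 1" using L36 by simp
  hence yA1: "y / A \<ge> 1" using yA by linarith
  have l: "L / 4 > 0" using L36 by simp
  note * = card_primes_interval[OF A_def yA1 l lyA' ly(2)]
  show "finite (Q (val r))" using *(1) by (simp add: Q_def y_def)
  show "real (card (Q (val r))) \<ge> N / (A * L) * (1 / real (val r))"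
    using *(2) by (simp add: Q_def y_def mult_ac)
  \<comment> \<open>68 = 4 * 17, from the lower bound \<open>L / 4\<close> for the logarithm of a
    top prime.\<close>
  show "real (card (Q (val r))) \<le> 68 * N / L * (1 / real (val r))"
    using *(3) by (simp add: Q_def y_def field_simps)
  show "real q > exp (L / 4)" if "q \<in> Q (val r)" using that yA by (auto simp: Q_def y_def)
qed

lemma finite_TT: "finite TT"
  unfolding TT_def using finite_T Q_bounds(1) by (intro finite_SigmaI) auto

lemma tv_mem: "\<tau> \<in> TT \<Longrightarrow> tv \<tau> \<in> pos_upto N"
proof -
  assume t: "\<tau> \<in> TT"
  hence v: "val (fst \<tau>) > 0" and q: "snd \<tau> \<in> Q (val (fst \<tau>))"
    using val_pos by (auto simp: TT_def)
  hence "real (snd \<tau>) * real (val (fst \<tau>)) \<le> N" "snd \<tau> > 0"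
    by (auto simp: Q_def pos_le_divide_eq intro: prime_gt_0_nat)
  thus ?thesis using v by (simp add: pos_upto_def tv_def mult.commute)
qed

lemma card_TT_ge: "real (card TT) \<ge> N / (A * L) * (\<Prod>i<k. S i ^ t)"
proof -
  have "N / (A * L) * (\<Prod>i<k. S i ^ t) = (\<Sum>r\<in>T. N / (A * L) * (1 / real (val r)))"
    unfolding sum_T[symmetric] by (simp add: sum_distrib_left)
  also have "\<dots> \<le> (\<Sum>r\<in>T. real (card (Q (val r))))"
    by (intro sum_mono Q_bounds(2))
  also have "\<dots> = real (card TT)"
    unfolding TT_def using finite_T Q_bounds(1) by (subst card_SigmaI) auto
  finally show ?thesis .
qed

text \<open>Top primes exceed \<open>exp (L / 4)\<close>, block primes do not.\<close>

lemma coprime_val: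
  assumes "r \<in> T" "r' \<in> T" "q \<in> Q (val r')"
  shows "\<not> q dvd val r"
proof
  assume dvd: "q dvd val r"
  have q: "prime q" "real q > exp (L / 4)" using Q_bounds(4)[OF assms(2,3)] assms(3) by (auto simp: Q_def)
  then obtain x where x: "x \<in> J" "q dvd r x"
    using dvd by (auto simp: val_def prime_dvd_prod_iff)
  have "r x \<in> P (fst x)" using assms(1) x unfolding T_def by (auto dest: PiE_mem)
  hence "prime (r x)" "real (r x) \<le> exp (L / 4)" using primeP small blk_less(3)[OF x(1)] by blast+
  moreover have "q = r x" using q x calculation(1) by (simp add: primes_dvd_imp_eq)
  ultimately show False using q by simp
qed

text \<open>A common top prime makes the intervals of the two values overlap, and each interval has
  endpoint ratio \<open>A\<close>.\<close>

lemma near_of_common: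
  assumes "r \<in> T" "r' \<in> T" "q \<in> Q (val r)" "q \<in> Q (val r')"
  shows "near A (val r) (val r')"
proof -
  have A: "A > 0" and N0: "N > 0" using A_def N by auto
  have v: "real (val r) > 0" "real (val r') > 0" using val_pos assms by auto
  have "N / real (val r) / A \<le> N / real (val r')" "N / real (val r') / A \<le> N / real (val r)"
    using assms(3,4) by (auto simp: Q_def)
  thus ?thesis using v A N0 by (auto simp: near_def field_simps)
qed

text \<open>No top prime divides a block product, so unique factorization splits the equation into
  one for the top primes and one for the block products.\<close>

lemma top_primes_match:
  assumes "(r1, q1) \<in> TT" "(r2, q2) \<in> TT" "(r3, q3) \<in> TT" "(r4, q4) \<in> TT"
    and eq: "tv (r1, q1) * tv (r2, q2) = tv (r3, q3) * tv (r4, q4)"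
  shows "val r1 * val r2 = val r3 * val r4" "q1 = q3 \<and> q2 = q4 \<or> q1 = q4 \<and> q2 = q3"
proof -
  have r: "r1 \<in> T" "r2 \<in> T" "r3 \<in> T" "r4 \<in> T"
    and q: "q1 \<in> Q (val r1)" "q2 \<in> Q (val r2)" "q3 \<in> Q (val r3)" "q4 \<in> Q (val r4)"
    using assms by (auto simp: TT_def)
  hence pr: "prime q1" "prime q2" "prime q3" "prime q4" by (auto simp: Q_def)
  have nd: "\<not> q1 dvd val r3" "\<not> q1 dvd val r4" "\<not> q2 dvd val r3" "\<not> q2 dvd val r4"
    using coprime_val r q by blast+
  have eq': "(val r1 * val r2) * (q1 * q2) = (val r3 * val r4) * (q3 * q4)"
    using eq by (simp add: tv_def mult_ac)
  have match: "q2 = q'" "val r1 * val r2 = val r3 * val r4"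
    if "q1 * q' = q3 * q4" "prime q'" for q'
  proof -
    have "q1 * ((val r1 * val r2) * q2) = q1 * ((val r3 * val r4) * q')"
      using eq' unfolding that(1)[symmetric] by (simp add: mult_ac)
    hence e: "(val r1 * val r2) * q2 = (val r3 * val r4) * q'"
      using pr(1) by (simp add: prime_gt_0_nat)
    hence "q2 dvd (val r3 * val r4) * q'" by (metis dvd_triv_right)
    hence "q2 dvd q'" using nd pr(2) by (simp add: prime_dvd_mult_iff)
    thus "q2 = q'" using pr(2) that(2) by (simp add: primes_dvd_imp_eq)
    thus "val r1 * val r2 = val r3 * val r4" using e pr(2) by (simp add: prime_gt_0_nat)
  qed
  have "q1 dvd (val r3 * val r4) * (q3 * q4)" unfolding eq'[symmetric] by simp
  hence "q1 dvd q3 \<or> q1 dvd q4" using nd pr(1) by (simp add: prime_dvd_mult_iff)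
  hence "q1 = q3 \<or> q1 = q4" using pr primes_dvd_imp_eq by blast
  hence "val r1 * val r2 = val r3 * val r4 \<and> (q1 = q3 \<and> q2 = q4 \<or> q1 = q4 \<and> q2 = q3)"
  proof
    assume "q1 = q3"
    thus ?thesis using match[of q4] pr by simp
  next
    assume "q1 = q4"
    thus ?thesis using match[of q3] pr by (simp add: mult.commute)
  qed
  thus "val r1 * val r2 = val r3 * val r4" "q1 = q3 \<and> q2 = q4 \<or> q1 = q4 \<and> q2 = q3" by auto
qed

text \<open>The Boolean records which of the two matchings of the top primes occurs, whence the
  factor 2; in the second case the last two tuples are exchanged. For a fixed quadruple of tuples,
  \<open>q1\<close> and \<open>q2\<close> are counted independently.\<close>

lemma energy_count_le:
  defines "Z \<equiv> {(\<tau>1, \<tau>2, \<tau>3, \<tau>4). \<tau>1 \<in> TT \<and> \<tau>2 \<in> TT \<and> \<tau>3 \<in> TT \<and> \<tau>4 \<in> TT \<and> tv \<tau>1 * tv \<tau>2 = tv \<tau>3 * tv \<tau>4}"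
  shows "real (card Z) \<le> 2 * (68 * N / L)\<^sup>2 * (\<Sum>(r1, r2, r3, r4)\<in>quads. 1 / (real (val r1) * real (val r2)))"
proof -
  define I where "I = (SIGMA b:(UNIV::bool set). SIGMA \<rho>:quads. Q (val (fst \<rho>)) \<times> Q (val (fst (snd \<rho>))))"
  define dec where "dec = (\<lambda>(b, (r1, r2, r3, r4), (q1, q2)).
     if b then ((r1, q1), (r2, q2), (r3, q1), (r4, q2))
     else ((r1 :: nat \<times> nat \<Rightarrow> nat, q1 :: nat), (r2 :: nat \<times> nat \<Rightarrow> nat, q2 :: nat),
           (r4 :: nat \<times> nat \<Rightarrow> nat, q2), (r3 :: nat \<times> nat \<Rightarrow> nat, q1)))"
  have quadsT: "fst \<rho> \<in> T" "fst (snd \<rho>) \<in> T" if "\<rho> \<in> quads" for \<rho>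
    using that by (auto simp: quads_def)
  have finQ: "finite (Q (val (fst \<rho>)) \<times> Q (val (fst (snd \<rho>))))" if "\<rho> \<in> quads" for \<rho>
    using Q_bounds(1) quadsT[OF that] by (intro finite_cartesian_product)
  have fin2: "finite (SIGMA \<rho>:quads. Q (val (fst \<rho>)) \<times> Q (val (fst (snd \<rho>))))"
    by (rule finite_SigmaI[OF finite_quads finQ])
  have finI: "finite I" unfolding I_def by (rule finite_SigmaI[OF finite fin2])
  have finZ: "finite Z"
    by (rule finite_subset[of _ "TT \<times> TT \<times> TT \<times> TT"]) (use finite_TT in \<open>auto simp: Z_def\<close>)
  have "real (card Z) = (\<Sum>z\<in>Z. 1)" by simp
  also have "\<dots> \<le> (\<Sum>y\<in>I. 1)"
  proof (rule sum_le_included[where i = dec])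
    show "\<forall>z\<in>Z. \<exists>y\<in>I. dec y = z \<and> (1::real) \<le> 1"
    proof
      fix z assume z: "z \<in> Z"
      obtain r1 q1 r2 q2 r3 q3 r4 q4 where zz: "z = ((r1, q1), (r2, q2), (r3, q3), (r4, q4))"
        by (metis surj_pair)
      have m: "(r1, q1) \<in> TT" "(r2, q2) \<in> TT" "(r3, q3) \<in> TT" "(r4, q4) \<in> TT"
        and eq: "tv (r1, q1) * tv (r2, q2) = tv (r3, q3) * tv (r4, q4)"
        using z unfolding Z_def zz by auto
      note tm = top_primes_match[OF m eq]
      have r: "r1 \<in> T" "r2 \<in> T" "r3 \<in> T" "r4 \<in> T"
        and q: "q1 \<in> Q (val r1)" "q2 \<in> Q (val r2)" "q3 \<in> Q (val r3)" "q4 \<in> Q (val r4)"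
        using m by (auto simp: TT_def)
      show "\<exists>y\<in>I. dec y = z \<and> (1::real) \<le> 1"
      proof (cases "q1 = q3 \<and> q2 = q4")
        case True
        hence "(r1, r2, r3, r4) \<in> quads"
          using tm(1) r q near_of_common[OF r(1,3) q(1)] by (auto simp: quads_def)
        hence "(True, (r1, r2, r3, r4), (q1, q2)) \<in> I" using q by (simp add: I_def)
        thus ?thesis by (rule bexI[rotated]) (use True zz in \<open>simp add: dec_def\<close>)
      next
        case False
        hence F: "q1 = q4" "q2 = q3" using tm(2) by auto
        hence "(r1, r2, r4, r3) \<in> quads"
          using tm(1) r q near_of_common[OF r(1,4) q(1)] by (auto simp: quads_def mult.commute)
        hence "(False, (r1, r2, r4, r3), (q1, q2)) \<in> I" using q by (simp add: I_def)
        thus ?thesis by (rule bexI[rotated]) (use F zz in \<open>simp add: dec_def\<close>)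
      qed
    qed
  qed (use finI finZ in auto)
  also have "\<dots> = real (card I)" by simp
  also have "card I = 2 * (\<Sum>\<rho>\<in>quads. card (Q (val (fst \<rho>))) * card (Q (val (fst (snd \<rho>)))))"
  proof -
    have "card (SIGMA \<rho>:quads. Q (val (fst \<rho>)) \<times> Q (val (fst (snd \<rho>)))) =
      (\<Sum>\<rho>\<in>quads. card (Q (val (fst \<rho>))) * card (Q (val (fst (snd \<rho>)))))"
      using finQ finite_quads by (subst card_SigmaI) (simp_all add: card_cartesian_product)
    thus ?thesis unfolding I_def by (simp add: card_cartesian_product)
  qed
  also have "real \<dots> = 2 * (\<Sum>\<rho>\<in>quads. real (card (Q (val (fst \<rho>)))) * real (card (Q (val (fst (snd \<rho>))))))"
    by simp
  also have "\<dots> \<le> 2 * (\<Sum>\<rho>\<in>quads. (68 * N / L * (1 / real (val (fst \<rho>)))) * (68 * N / L * (1 / real (val (fst (snd \<rho>))))))"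
    using Q_bounds(3) quadsT L36 N
    by (intro mult_left_mono sum_mono mult_mono) auto
  also have "\<dots> = 2 * (68 * N / L)\<^sup>2 * (\<Sum>\<rho>\<in>quads. 1 / (real (val (fst \<rho>)) * real (val (fst (snd \<rho>)))))"
    unfolding sum_distrib_left by (intro sum.cong refl) (simp add: power2_eq_square)
  finally show ?thesis by (simp add: case_prod_unfold)
qed

lemma S_ge_one: "i < k \<Longrightarrow> S i \<ge> 1"
  using S1 by (simp add: S_def)

text \<open>The powers of \<open>N\<close> cancel. The energy carries \<open>L\<close> to the power
  -2 and the fourth power of the norm \<open>L\<close> to the power -4, which leaves
  \<open>L\<^sup>2\<close>; 9248 = 2 * 68^2.\<close>

theorem min_energy_level_le:
  "min_energy N \<le> 9248 * A ^ 4 * L\<^sup>2 *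
     ((\<Sum>m\<le>k. fact (2 * t) ^ m * (fact t)\<^sup>2 ^ (k - m) * G m) / (\<Prod>i<k. S i ^ (2 * t)))"
proof -
  define ss where "ss = (\<Sum>m\<le>k. fact (2 * t) ^ m * (fact t)\<^sup>2 ^ (k - m) * G m)"
  define pp where "pp = (\<Prod>i<k. S i ^ t)"
  have pp: "pp > 0" unfolding pp_def using S_ge_one by (intro prod_pos) force
  have pp2: "(\<Prod>i<k. S i ^ (2 * t)) = pp\<^sup>2"
    unfolding pp_def by (simp add: prod_power_distrib power_mult[symmetric] mult.commute)
  have A: "A > 0" and N0: "N > 0" and L: "L > 0" using A_def N L36 by auto
  have nrm: "weight_norm N weight = real (card TT)"
    unfolding weight_def by (rule weight_norm_card[OF finite_TT tv_mem])
  have base: "N / (A * L) * pp > 0" using A N0 L pp by simp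
  have ge: "weight_norm N weight \<ge> N / (A * L) * pp"
    using card_TT_ge unfolding nrm pp_def .
  have adm: "admissible_weight N weight"
  proof -
    have "\<exists>m\<in>pos_upto N. weight m \<noteq> 0"
    proof (rule ccontr)
      assume "\<not> ?thesis"
      hence "weight_norm N weight = 0" by (simp add: weight_norm_def)
      thus False using ge base by linarith
    qed
    thus ?thesis by (simp add: admissible_weight_def weight_def)
  qed
  have "weighted_energy N weight \<le> 2 * (68 * N / L)\<^sup>2 * (\<Sum>(r1, r2, r3, r4)\<in>quads. 1 / (real (val r1) * real (val r2)))"
    using weighted_energy_card_le[OF finite_TT, of N tv] energy_count_le
    unfolding weight_def by linarith
  also have "\<dots> \<le> 2 * (68 * N / L)\<^sup>2 * (ss * pp\<^sup>2)"
    using log_energy_le unfolding ss_def pp2[symmetric] by (intro mult_left_mono) auto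
  finally have en: "weighted_energy N weight \<le> 2 * (68 * N / L)\<^sup>2 * (ss * pp\<^sup>2)" .
  have ss0: "ss \<ge> 0" unfolding ss_def by (intro sum_nonneg mult_nonneg_nonneg Gnonneg) auto
  have "min_energy N \<le> N\<^sup>2 * weighted_energy N weight / weight_norm N weight ^ 4"
    by (rule min_energy_le[OF adm])
  also have "\<dots> \<le> N\<^sup>2 * (2 * (68 * N / L)\<^sup>2 * (ss * pp\<^sup>2)) / (N / (A * L) * pp) ^ 4"
    using en ge base ss0 by (intro frac_le mult_left_mono power_mono zero_less_power) (auto intro!: mult_nonneg_nonneg)
  also have "\<dots> = 9248 * A ^ 4 * L\<^sup>2 * (ss / pp\<^sup>2)"
    using A N0 L pp by (simp add: field_simps power2_eq_square power4_eq_xxxx)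
  finally show ?thesis unfolding ss_def pp2 .
qed

end

section \<open>Factorial bounds and the choice of parameters\<close>

text \<open>A weak Stirling bound; its induction step is (t + 1) ln ((t + 1) / t) \<ge> 1.\<close>

lemma ln_fact_le:
  "t \<ge> 1 \<Longrightarrow> ln (fact t :: real) \<le> (real t + 1) * ln (real t) - real t + 1"
proof (induction t rule: nat_induct_at_least)
  case (Suc t)
  have t: "real t \<ge> 1" using Suc by simp
  have "ln (real t / (real t + 1)) \<le> real t / (real t + 1) - 1"
    using t by (intro ln_le_minus_one) auto
  moreover have "ln (real t / (real t + 1)) = ln (real t) - ln (real t + 1)"
    using t by (simp add: ln_div)
  moreover have "real t / (real t + 1) - 1 = - (1 / (real t + 1))"
    using t by (simp add: field_simps)
  ultimately have "1 / (real t + 1) \<le> ln (real t + 1) - ln (real t)" by linarith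
  hence "(real t + 1) * (1 / (real t + 1)) \<le> (real t + 1) * (ln (real t + 1) - ln (real t))"
    using t by (intro mult_left_mono) auto
  hence *: "1 \<le> (real t + 1) * (ln (real t + 1) - ln (real t))" using t by simp
  have "ln (fact (Suc t) :: real) = ln (real t + 1) + ln (fact t)"
    using t by (simp add: ln_mult add.commute)
  thus ?case using Suc.IH * by (simp add: algebra_simps)
qed simp

text \<open>The central binomial coefficient is at most its row sum.\<close>

lemma fact_double_le: "(fact (2 * t) :: real) \<le> 4 ^ t * (fact t)\<^sup>2"
proof -
  have "(2 * t) choose t \<le> (\<Sum>j\<le>2 * t. (2 * t) choose j)"
    by (intro member_le_sum) auto
  also have "\<dots> = 4 ^ t" by (simp add: choose_row_sum power_mult)
  finally have "(fact t)\<^sup>2 * ((2 * t) choose t) \<le> (fact t)\<^sup>2 * (4 ^ t :: nat)" by simp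
  moreover have "(fact t)\<^sup>2 * ((2 * t) choose t) = (fact (2 * t) :: nat)"
    using binomial_fact_lemma[of t "2 * t"] by (simp add: power2_eq_square mult_2)
  ultimately have "real (fact (2 * t)) \<le> real ((fact t)\<^sup>2 * 4 ^ t)" by (simp only: of_nat_le_iff)
  thus ?thesis by (simp add: mult.commute)
qed

text \<open>Here ln N = exp (K l), so the ln ln scale splits into \<open>K\<close> slots of length
  \<open>l\<close>. The condition \<open>4 ^ t \<le> exp l\<close> lets the confinement saving of
  order exp (-m l) absorb the excess of mixing permutations, so that all \<open>m\<close> satisfy
  the same bound.\<close>

lemma min_energy_exp_exp_le:
  fixes K k t :: nat and l s :: real
  assumes K: "K = k + 2" and l: "4 \<le> exp l" "36 \<le> exp (real K * l)"
    and t: "4 ^ t \<le> exp l" "2 * real (t * k) \<le> exp l" and s: "s \<ge> 1"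
    and primes: "\<And>Y. Y \<ge> exp l \<Longrightarrow>
       (\<Sum>p | prime p \<and> exp Y < real p \<and> real p \<le> exp (Y * exp l). 1 / real p) \<ge> s"
  shows "min_energy (exp (exp (real K * l))) \<le>
    249696 * exp 36 * (real k + 1) * exp (2 * real K * l) * (fact t / s ^ t) ^ (2 * k)"
proof -
  have l0: "l > 0" using l(1) by (metis exp_le_one_iff le_numeral_extra(4) linorder_not_le numeral_le_one_iff order_trans semiring_norm(69))
  define u where "u i = exp (real i * l)" for i :: nat
  have u1: "u i \<ge> 1" for i unfolding u_def using l0 by simp
  have umono: "u i \<le> u j" if "i \<le> j" for i j unfolding u_def using l0 that by simp
  have uSuc: "u (Suc i) = u i * exp l" for i unfolding u_def by (simp add: algebra_simps flip: exp_add)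
  \<comment> \<open>The first and the last of the \<open>K\<close> slots are left out; the last one
    provides the room for the top prime.\<close>
  define P where "P i = {p::nat. prime p \<and> exp (u (Suc i)) < real p \<and> real p \<le> exp (u (Suc (Suc i)))}" for i
  define A where "A = exp (9::real)"
  \<comment> \<open>27 = 18 + 9, where 18 is the logarithm of \<open>A\<^sup>2\<close> and 9 the
    error for closed intervals; primes of block \<open>m - 1\<close> have logarithm at least
    \<open>u m\<close>.\<close>
  define G where "G m = (if m = 0 then 1 else 27 / u m)" for m :: nat
  have finP: "finite (P i)" for i
    unfolding P_def by (rule finite_subset[OF _ finite_primes_real_le[of "exp (u (Suc (Suc i)))"]]) auto
  have SP: "(\<Sum>p\<in>P i. 1 / real p) \<ge> s" for i
  proof -
    have "u (Suc i) \<ge> exp l" using umono[of 1 "Suc i"] by (simp add: u_def)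
    thus ?thesis using primes[of "u (Suc i)"] unfolding P_def uSuc[of "Suc i"] by simp
  qed
  have disj: "i = j" if "p \<in> P i" "p \<in> P j" for i j p
  proof -
    have "\<not> i < j" if "p \<in> P i" "p \<in> P j" for i j
    proof
      assume "i < j"
      hence "exp (u (Suc (Suc i))) \<le> exp (u (Suc j))" using umono by simp
      moreover have "real p \<le> exp (u (Suc (Suc i)))" "exp (u (Suc j)) < real p"
        using that unfolding P_def by blast+
      ultimately show False by linarith
    qed
    thus ?thesis using that by (meson linorder_neqE_nat)
  qed
  have GS: "(\<Sum>p | p \<in> P i \<and> z \<le> real p \<and> real p \<le> A\<^sup>2 * z. 1 / real p) \<le> G (Suc i)" if z: "z > 0" for i z
  proof -
    let ?I = "{p. p \<in> P i \<and> z \<le> real p \<and> real p \<le> A\<^sup>2 * z}"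
    have up: "u (Suc i) > 0" using u1[of "Suc i"] by linarith
    have A1: "A \<ge> 1" "A\<^sup>2 \<ge> 1" unfolding A_def by (simp_all add: power2_eq_square flip: exp_add)
    have pp: "u (Suc i) \<le> ln (real p)" "real p > 0" if "p \<in> ?I" for p
    proof -
      have p: "exp (u (Suc i)) < real p" using that by (simp add: P_def)
      thus "real p > 0" using exp_gt_zero[of "u (Suc i)"] by linarith
      thus "u (Suc i) \<le> ln (real p)" using p by (simp add: ln_ge_iff)
    qed
    have "u (Suc i) * (\<Sum>p\<in>?I. 1 / real p) = (\<Sum>p\<in>?I. u (Suc i) * (1 / real p))"
      by (rule sum_distrib_left)
    also have "\<dots> \<le> (\<Sum>p\<in>?I. ln (real p) * (1 / real p))"
      using pp by (intro sum_mono mult_right_mono) auto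
    also have "\<dots> = (\<Sum>p\<in>?I. ln (real p) / real p)" by simp
    also have "\<dots> \<le> (\<Sum>p | prime p \<and> z \<le> real p \<and> real p \<le> A\<^sup>2 * z. ln (real p) / real p)"
    proof (rule sum_mono2)
      show "finite {p. prime p \<and> z \<le> real p \<and> real p \<le> A\<^sup>2 * z}"
        by (rule finite_subset[OF _ finite_primes_real_le[of "A\<^sup>2 * z"]]) auto
      show "?I \<subseteq> {p. prime p \<and> z \<le> real p \<and> real p \<le> A\<^sup>2 * z}" by (auto simp: P_def)
      fix p assume "p \<in> {p. prime p \<and> z \<le> real p \<and> real p \<le> A\<^sup>2 * z} - ?I"
      hence "real p \<ge> 1" using prime_ge_1_nat by fastforce
      thus "0 \<le> ln (real p) / real p" by simp
    qed
    also have "\<dots> \<le> ln (A\<^sup>2 * z / z) + 9"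
      using z A1 by (intro sum_ln_prime_div_closed_le) auto
    also have "\<dots> = 27" using z by (simp add: A_def ln_realpow)
    finally show ?thesis using up by (simp add: G_def field_simps)
  qed
  interpret prime_blocks k t P A G
  proof
    show "A \<ge> 1" by (simp add: A_def)
    show "G i \<ge> 0" for i using u1[of i] by (simp add: G_def)
    show "(\<Sum>p\<in>P i. 1 / real p) \<ge> 1" for i using SP[of i] s by linarith
    show "finite (P i)" for i by (rule finP)
    show "prime p" if "p \<in> P i" for p i using that by (simp add: P_def)
    show "i = j" if "p \<in> P i" "p \<in> P j" for i j p using disj that .
    show "G 0 = 1" by (simp add: G_def)
  qed (rule GS)
  have uK: "u K = u (Suc k) * exp l" unfolding K using uSuc[of "Suc k"] by simp
  have Ple: "real p \<le> exp (u (Suc k))" if "i < k" "p \<in> P i" for i p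
  proof -
    have "real p \<le> exp (u (Suc (Suc i)))" using that by (simp add: P_def)
    also have "\<dots> \<le> exp (u (Suc k))" using umono that by simp
    finally show ?thesis .
  qed
  interpret prime_blocks_level k t P A G "exp (u K)" "u K"
  proof
    show "A = exp 9" by (simp add: A_def)
    show "36 \<le> u K" using l by (simp add: u_def)
    show "real p \<le> exp (u K / 4)" if "i < k" "p \<in> P i" for i p
    proof -
      \<comment> \<open>\<open>exp l \<ge> 4\<close> keeps the block primes below the fourth root of
        N.\<close>
      have "u (Suc k) * 4 \<le> u (Suc k) * exp l" using l u1[of "Suc k"] by (intro mult_left_mono) auto
      hence "exp (u (Suc k)) \<le> exp (u K / 4)" unfolding uK by simp
      thus ?thesis using Ple[OF that] by linarith
    qed
    show "real (val r) \<le> exp (u K / 2)" if r: "r \<in> T" for r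
    proof -
      have "real (val r) = (\<Prod>x\<in>J. real (r x))" by (simp add: val_def)
      also have "\<dots> \<le> (\<Prod>x\<in>J. exp (u (Suc k)))"
      proof (rule prod_mono)
        fix x assume x: "x \<in> J"
        have "r x \<in> P (fst x)" using r x unfolding T_def by (auto dest: PiE_mem)
        thus "0 \<le> real (r x) \<and> real (r x) \<le> exp (u (Suc k))" using Ple blk_less(3)[OF x] by simp
      qed
      also have "\<dots> = exp (real (t * k) * u (Suc k))"
        by (simp add: J_def card_cartesian_product exp_of_nat_mult[symmetric] mult.commute)
      also have "\<dots> \<le> exp (u K / 2)"
      proof -
        \<comment> \<open>A product of \<open>t * k\<close> block primes thereby stays below the
          square root of N.\<close>
        have "2 * real (t * k) * u (Suc k) \<le> exp l * u (Suc k)"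
          using t(2) u1[of "Suc k"] by (intro mult_right_mono) auto
        thus ?thesis unfolding uK by (simp add: mult.commute)
      qed
      finally show ?thesis .
    qed
  qed auto
  have "(\<Sum>m\<le>k. fact (2 * t) ^ m * (fact t)\<^sup>2 ^ (k - m) * G m) \<le> (\<Sum>m\<le>k. 27 * (fact t) ^ (2 * k))"
  proof (rule sum_mono)
    fix m assume m: "m \<in> {..k}"
    have um: "u m > 0" using u1[of m] by linarith
    have "fact (2 * t) \<le> exp l * (fact t)\<^sup>2"
      using fact_double_le[of t] mult_right_mono[OF t(1), of "(fact t)\<^sup>2"]
        zero_le_power2[of "fact t :: real"] by linarith
    hence "fact (2 * t) ^ m \<le> (exp l * (fact t)\<^sup>2) ^ m" by (intro power_mono) auto
    also have "\<dots> = u m * (fact t)\<^sup>2 ^ m"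
      by (simp add: u_def power_mult_distrib exp_of_nat_mult[symmetric])
    finally have 1: "fact (2 * t) ^ m \<le> u m * (fact t)\<^sup>2 ^ m" .
    have 2: "G m \<le> 27 / u m" by (simp add: G_def u_def)
    \<comment> \<open>The excess \<open>u m\<close> of mixing permutations cancels against the
      saving \<open>27 / u m\<close>.\<close>
    have "fact (2 * t) ^ m * (fact t)\<^sup>2 ^ (k - m) * G m \<le> (u m * (fact t)\<^sup>2 ^ m) * (fact t)\<^sup>2 ^ (k - m) * (27 / u m)"
      using 1 2 um by (intro mult_mono Gnonneg) auto
    also have "\<dots> = 27 * ((fact t)\<^sup>2 ^ m * (fact t)\<^sup>2 ^ (k - m))" using um by simp
    also have "(fact t :: real)\<^sup>2 ^ m * (fact t)\<^sup>2 ^ (k - m) = fact t ^ (2 * k)"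
      using m by (simp add: power_mult flip: power_add)
    finally show "fact (2 * t) ^ m * (fact t)\<^sup>2 ^ (k - m) * G m \<le> 27 * (fact t) ^ (2 * k)" .
  qed
  also have "\<dots> = 27 * (real k + 1) * (fact t) ^ (2 * k)" by (simp add: algebra_simps)
  finally have num: "(\<Sum>m\<le>k. fact (2 * t) ^ m * (fact t)\<^sup>2 ^ (k - m) * G m) \<le> 27 * (real k + 1) * (fact t) ^ (2 * k)" .
  have "(\<Prod>i<k. s ^ (2 * t)) \<le> (\<Prod>i<k. S i ^ (2 * t))"
    using SP s by (intro prod_mono conjI power_mono) (auto simp: S_def)
  hence den: "(s ^ t) ^ (2 * k) \<le> (\<Prod>i<k. S i ^ (2 * t))"
    by (simp add: mult_ac flip: power_mult)
  have "min_energy (exp (u K)) \<le> 9248 * A ^ 4 * (u K)\<^sup>2 *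
     ((\<Sum>m\<le>k. fact (2 * t) ^ m * (fact t)\<^sup>2 ^ (k - m) * G m) / (\<Prod>i<k. S i ^ (2 * t)))"
    by (rule min_energy_level_le)
  also have "\<dots> \<le> 9248 * A ^ 4 * (u K)\<^sup>2 * ((27 * (real k + 1) * (fact t) ^ (2 * k)) / (s ^ t) ^ (2 * k))"
    using num den s by (intro mult_left_mono frac_le) (auto simp: A_def)
  \<comment> \<open>249696 = 27 * 9248.\<close>
  also have "\<dots> = 249696 * A ^ 4 * (real k + 1) * (u K)\<^sup>2 * (fact t / s ^ t) ^ (2 * k)"
    by (simp add: power_divide)
  also have "A ^ 4 = exp 36" by (simp add: A_def exp_of_nat_mult[symmetric])
  also have "(u K)\<^sup>2 = exp (2 * real K * l)" by (simp add: u_def exp_double[symmetric] mult_ac)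
  finally show ?thesis by (simp add: u_def)
qed

text \<open>With \<open>t \<le> kappa * l\<close> primes from each block, \<open>4 ^ t \<le> exp l\<close>: this is the largest constant with
  that property.\<close>

definition kappa :: real where "kappa = 1 / (2 * ln 2)"

lemma kappa_pos: "kappa > 0"
  by (simp add: kappa_def)

text \<open>The form in which the exponent arises: 2 comes from the factor \<open>L\<^sup>2\<close>,
  and 2 kappa (ln kappa - 1) is the Stirling value, per unit of \<open>l\<close>, of the logarithm
  of \<open>(fact t / s ^ t)\<^sup>2\<close> for t = kappa l and s close to l.\<close>

lemma delta_kappa: "delta = 2 + 2 * kappa * ln kappa - 2 * kappa"
proof -
  have "ln kappa = - ln 2 - ln (ln 2)"
    unfolding kappa_def by (simp add: ln_div ln_mult)
  thus ?thesis unfolding delta_def by (simp only:) (simp add: kappa_def field_simps)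
qed

text \<open>Using \<open>k\<close> of \<open>K\<close> blocks gives an exponent of about 2 + (k / K)
  (delta - 2), which approaches \<open>delta\<close> as \<open>K\<close> grows; \<open>K\<close> is
  fixed first and \<open>l\<close> tends to infinity.\<close>

theorem min_energy_upper:
  fixes \<eta> :: real
  assumes \<eta>: "\<eta> > 0"
  shows "\<forall>\<^sub>F N in at_top. min_energy N \<le> ln N powr (delta + \<eta>)"
proof -
  \<comment> \<open>2 B = 2 - delta is the cost of an omitted block. Two are omitted, and
    \<open>K\<close> is taken so large that 4 B is at most half of K \<eta>.\<close>
  define B where "B = kappa - kappa * ln kappa"
  define k where "k = nat \<lceil>8 * \<bar>B\<bar> / \<eta>\<rceil> + 1"
  define K where "K = k + 2"
  have "8 * \<bar>B\<bar> / \<eta> \<le> real K" unfolding K_def k_def by linarith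
  hence KB: "8 * B \<le> real K * \<eta>" using \<eta> by (simp add: field_simps)
  have K0: "real K > 0" by (simp add: K_def)
  \<comment> \<open>The loss factor in the prime reciprocal sums: with about kappa l primes per
    block it costs about \<eta> l / 8 in the logarithm of \<open>s ^ t\<close>.\<close>
  define \<theta> where "\<theta> = exp (- (\<eta> / (8 * kappa)))"
  have \<theta>: "0 < \<theta>" "\<theta> < 1" using \<eta> kappa_pos by (auto simp: \<theta>_def)
  \<comment> \<open>The limiting value of ln (t! / s^t) / t.\<close>
  define c where "c = ln kappa + \<eta> / (8 * kappa) - 1"
  define C where "C = 249696 * exp (36::real) * (real k + 1)"
  have C: "C > 0" by (simp add: C_def add_pos_nonneg)
  define T where "T l = nat \<lfloor>kappa * l\<rfloor>" for l
  \<comment> \<open>The coefficient of \<open>l\<close> in the target exponent minus that in the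
    bound obtained; its positivity absorbs the lower-order terms.\<close>
  define a where "a = real K * (delta + \<eta>) - 2 * real K - 2 * real k * kappa * c"
  have a: "a > 0"
  proof -
    have k: "real k = real K - 2" by (simp add: K_def)
    have "2 * kappa * c = 2 * kappa * ln kappa - 2 * kappa + \<eta> / 4"
      using kappa_pos by (simp add: c_def field_simps)
    hence e: "2 * kappa * c = delta - 2 + \<eta> / 4" by (simp add: delta_kappa)
    have "a = real K * (delta + \<eta>) - 2 * real K - (real K - 2) * (2 * kappa * c)"
      unfolding a_def k by (simp add: algebra_simps)
    also have "\<dots> = real K * \<eta> * 3 / 4 + 2 * (2 * kappa * c)" unfolding e by (simp add: field_simps)
    also have "2 * (2 * kappa * c) = - 4 * B + \<eta> / 2"
      using kappa_pos by (simp add: c_def B_def field_simps)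
    finally have "a = real K * \<eta> * 3 / 4 - 4 * B + \<eta> / 2" by simp
    moreover have "real K * \<eta> > 0" using K0 \<eta> by simp
    ultimately show ?thesis using KB \<eta> by linarith
  qed
  have "\<forall>\<^sub>F l in at_top. 4 \<le> exp l \<and> 36 \<le> exp (real K * l) \<and> 2 * (kappa * l) * real k \<le> exp l \<and>
      \<theta> * l \<ge> 1 \<and> kappa * l \<ge> 1 \<and> l > 0"
  proof (intro eventually_conj)
    have 1: "filterlim (\<lambda>l::real. exp l) at_top at_top" by real_asymp
    show "\<forall>\<^sub>F l::real in at_top. 4 \<le> exp l" using 1 by (simp add: filterlim_at_top)
    have 2: "filterlim (\<lambda>l::real. exp (real K * l)) at_top at_top" using K0 by real_asymp
    show "\<forall>\<^sub>F l::real in at_top. 36 \<le> exp (real K * l)" using 2 by (simp add: filterlim_at_top)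
    have "filterlim (\<lambda>l::real. exp l - 2 * (kappa * l) * real k) at_top at_top" by real_asymp
    hence "\<forall>\<^sub>F l in at_top. 0 \<le> exp l - 2 * (kappa * l) * real k"
      unfolding filterlim_at_top by blast
    thus "\<forall>\<^sub>F l in at_top. 2 * (kappa * l) * real k \<le> exp l" by eventually_elim simp
    have "filterlim (\<lambda>l::real. \<theta> * l) at_top at_top" using \<theta> by real_asymp
    thus "\<forall>\<^sub>F l in at_top. \<theta> * l \<ge> 1" by (simp add: filterlim_at_top)
    have "filterlim (\<lambda>l::real. kappa * l) at_top at_top" using kappa_pos by real_asymp
    thus "\<forall>\<^sub>F l in at_top. kappa * l \<ge> 1" by (simp add: filterlim_at_top)
  qed (rule eventually_gt_at_top)
  moreover have "\<forall>\<^sub>F l in at_top. \<forall>Y\<ge>exp l.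
    (\<Sum>p | prime p \<and> exp Y < real p \<and> real p \<le> exp (Y * exp l). 1 / real p) \<ge> (1 - (1 - \<theta>)) * l"
    by (rule sum_prime_reciprocals_block_asymp) (use \<theta> in simp)
  moreover have "\<forall>\<^sub>F l in at_top. ln C + 2 * real k * (\<bar>c\<bar> + ln (kappa * l) + 1) \<le> a * l"
  proof -
    have "filterlim (\<lambda>l::real. a * l - (ln C + 2 * real k * (\<bar>c\<bar> + ln (kappa * l) + 1))) at_top at_top"
      using a kappa_pos by real_asymp
    hence "\<forall>\<^sub>F l in at_top. 0 \<le> a * l - (ln C + 2 * real k * (\<bar>c\<bar> + ln (kappa * l) + 1))"
      unfolding filterlim_at_top by blast
    thus ?thesis by eventually_elim simp
  qed
  ultimately have "\<forall>\<^sub>F l in at_top. min_energy (exp (exp (real K * l))) \<le> exp (real K * l) powr (delta + \<eta>)"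
  proof eventually_elim
    case (elim l)
    define t where "t = T l"
    define s where "s = \<theta> * l"
    have kl: "kappa * l \<ge> 1" and l0: "l > 0" and s1: "s \<ge> 1" using elim by (auto simp: s_def)
    have t: "real t \<le> kappa * l" "real t \<ge> kappa * l - 1" "t \<ge> 1"
      unfolding t_def T_def using kl by linarith+
    have "ln (4 ^ t :: real) = real t * (2 * ln 2)"
      using ln_realpow[of "2::real" 2] by (simp add: ln_realpow)
    also have "\<dots> \<le> kappa * l * (2 * ln 2)" using t by (intro mult_right_mono) auto
    also have "\<dots> = l" by (simp add: kappa_def)
    finally have "exp (ln (4 ^ t :: real)) \<le> exp l" by (simp only: exp_le_cancel_iff)
    moreover have "exp (ln (4 ^ t :: real)) = 4 ^ t" by (rule exp_ln) simp
    ultimately have t4: "4 ^ t \<le> exp l" by (simp only:)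
    have tk: "2 * real (t * k) \<le> exp l"
    proof -
      have "2 * real (t * k) \<le> 2 * (kappa * l) * real k"
        using mult_right_mono[OF t(1), of "real k"] by simp
      thus ?thesis using elim by linarith
    qed
    have "min_energy (exp (exp (real K * l))) \<le> 
      249696 * exp 36 * (real k + 1) * exp (2 * real K * l) * (fact t / s ^ t) ^ (2 * k)"
      by (rule min_energy_exp_exp_le[OF K_def _ _ t4 tk s1]) (use elim in \<open>auto simp: s_def\<close>)
    also have "\<dots> = C * exp (2 * real K * l) * (fact t / s ^ t) ^ (2 * k)" by (simp add: C_def)
    also have "\<dots> = exp (ln C + 2 * real K * l + 2 * real k * ln (fact t / s ^ t))"
    proof -
      have "fact t / s ^ t > 0" using s1 by simp
      hence "(fact t / s ^ t) ^ (2 * k) = exp (real (2 * k) * ln (fact t / s ^ t))"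
        by (simp only: exp_of_nat_mult exp_ln)
      thus ?thesis using C by (simp add: exp_add)
    qed
    also have "\<dots> \<le> exp (real K * l * (delta + \<eta>))"
    proof -
      have "ln (fact t / s ^ t) = ln (fact t) - real t * ln s"
        using s1 by (simp add: ln_div ln_realpow)
      also have "ln s = ln l - \<eta> / (8 * kappa)"
        using \<theta> l0 by (simp add: s_def ln_mult) (simp add: \<theta>_def)
      also have "ln (fact t) - real t * (ln l - \<eta> / (8 * kappa)) \<le>
         (real t + 1) * ln (real t) - real t + 1 - real t * (ln l - \<eta> / (8 * kappa))"
        using ln_fact_le[OF t(3)] by simp
      also have "\<dots> = real t * (ln (real t) - ln l + \<eta> / (8 * kappa) - 1) + ln (real t) + 1"
        by (simp add: algebra_simps)
      also have "\<dots> \<le> real t * c + ln (kappa * l) + 1"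
      proof -
        have lt: "ln (real t) \<le> ln (kappa * l)" using t kl by (intro ln_mono) auto
        moreover have "ln (kappa * l) = ln kappa + ln l" using kappa_pos l0 by (simp add: ln_mult)
        ultimately have "ln (real t) - ln l + \<eta> / (8 * kappa) - 1 \<le> c" by (simp add: c_def)
        hence "real t * (ln (real t) - ln l + \<eta> / (8 * kappa) - 1) \<le> real t * c"
          by (intro mult_left_mono) auto
        thus ?thesis using lt by linarith
      qed
      also have "real t * c \<le> kappa * l * c + \<bar>c\<bar>"
      proof -
        have "(real t - kappa * l) * c \<le> \<bar>real t - kappa * l\<bar> * \<bar>c\<bar>"
          by (metis abs_ge_self abs_mult)
        also have "\<dots> \<le> 1 * \<bar>c\<bar>" using t by (intro mult_right_mono) auto
        finally show ?thesis by (simp add: algebra_simps)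
      qed
      finally have "ln (fact t / s ^ t) \<le> kappa * l * c + (\<bar>c\<bar> + ln (kappa * l) + 1)" by simp
      hence "2 * real k * ln (fact t / s ^ t) \<le> 2 * real k * (kappa * l * c + (\<bar>c\<bar> + ln (kappa * l) + 1))"
        by (intro mult_left_mono) auto
      also have "\<dots> = 2 * real k * kappa * c * l + 2 * real k * (\<bar>c\<bar> + ln (kappa * l) + 1)"
        by (simp add: algebra_simps)
      finally have "ln C + 2 * real K * l + 2 * real k * ln (fact t / s ^ t) \<le>
        2 * real K * l + 2 * real k * kappa * c * l + a * l" using elim by linarith
      also have "\<dots> = real K * l * (delta + \<eta>)" by (simp add: a_def algebra_simps)
      finally show ?thesis by simp
    qed
    also have "\<dots> = exp (real K * l) powr (delta + \<eta>)" by (simp add: powr_def mult.commute)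
    finally show ?case .
  qed
  \<comment> \<open>Every large \<open>N\<close> has the form exp (exp (K l)), with l = ln (ln N) /
    K.\<close>
  moreover have "filterlim (\<lambda>N::real. ln (ln N) / real K) at_top at_top"
    using K0 by real_asymp
  ultimately have "\<forall>\<^sub>F N in at_top. min_energy (exp (exp (real K * (ln (ln N) / real K)))) \<le>
      exp (real K * (ln (ln N) / real K)) powr (delta + \<eta>)"
    by (rule eventually_compose_filterlim)
  moreover have "\<forall>\<^sub>F N::real in at_top. N > 1" by (rule eventually_gt_at_top)
  ultimately show ?thesis
  proof eventually_elim
    case (elim N)
    have "exp (real K * (ln (ln N) / real K)) = ln N" using elim K0 by simp
    thus ?case using elim by simp
  qed
qed

section \<open>Even characters modulo a prime\<close>

locale odd_prime_primroot =
  fixes p g H :: nat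
  assumes prime_p: "prime p" and p_eq: "p = 2 * H + 1" and H_pos: "H > 0"
    and primroot: "residue_primroot p g"
begin

lemma p_gt_2: "p > 2"
  using p_eq H_pos by simp

lemma coprime_g: "coprime p g" and ord_g: "ord p g = 2 * H"
  using primroot prime_p by (auto simp: residue_primroot_def totient_prime p_eq)

lemma power_g_cong: "[g ^ i = g ^ j] (mod p) \<longleftrightarrow> [i = j] (mod 2 * H)"
  using order_divides_expdiff[OF coprime_g, of i j] by (simp add: ord_g)

lemma coprime_iff: "coprime a (int p) \<longleftrightarrow> \<not> int p dvd a"
proof
  assume c: "coprime a (int p)"
  show "\<not> int p dvd a"
  proof
    assume "int p dvd a"
    hence "is_unit (int p)" using c coprime_common_divisor[of a "int p" "int p"] by simp
    thus False using p_gt_2 by simp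
  qed
next
  assume "\<not> int p dvd a"
  hence "coprime (int p) a" using prime_p by (intro prime_imp_coprime) simp_all
  thus "coprime a (int p)" by (simp add: coprime_commute)
qed

lemma ex_dlog:
  assumes "coprime a (int p)"
  shows "\<exists>i. [a = int (g ^ i)] (mod int p)"
proof -
  define r where "r = nat (a mod int p)"
  have p0: "int p > 0" using p_gt_2 by simp
  have r: "int r = a mod int p" unfolding r_def using p0 by simp
  have "r < p" using r p0 by (metis of_nat_less_iff pos_mod_bound)
  moreover have "r \<noteq> 0" using r assms coprime_iff[of a] by (auto simp: dvd_eq_mod_eq_0)
  ultimately have "r \<in> totatives p"
    using prime_p by (auto simp: totatives_prime)
  then obtain i where "r = g ^ i mod p"
    using residue_primroot_is_generator[OF _ primroot] p_gt_2 unfolding bij_betw_def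
    by (auto simp: image_iff)
  hence "int r = int (g ^ i) mod int p" by (simp add: zmod_int)
  thus ?thesis using r by (intro exI[of _ i]) (simp add: cong_def)
qed

text \<open>The chosen exponent is determined only modulo \<open>2 * H\<close>; \<open>psi\<close>
  sees only its class modulo \<open>H\<close>.\<close>

definition dlog :: "int \<Rightarrow> nat" where "dlog a = (SOME i. [a = int (g ^ i)] (mod int p))"

lemma dlog: "coprime a (int p) \<Longrightarrow> [a = int (g ^ dlog a)] (mod int p)"
  unfolding dlog_def using ex_dlog by (rule someI_ex)

definition rt :: "nat \<Rightarrow> complex" where
  "rt j = exp (2 * of_real pi * \<i> * of_nat j / of_nat H)"

lemma rt_add: "rt (i + j) = rt i * rt j"
  by (simp add: rt_def add_divide_distrib algebra_simps flip: exp_add)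

lemma rt_eq_iff: "rt i = rt j \<longleftrightarrow> [i = j] (mod H)"
  unfolding rt_def using complex_root_unity_eq[of H i j] H_pos by (simp add: cong_def)

lemma rt_eq_1_iff: "rt i = 1 \<longleftrightarrow> H dvd i"
  unfolding rt_def using complex_root_unity_eq_1[of H i] H_pos by simp

lemma norm_rt: "norm (rt i) = 1"
proof -
  have "rt i = exp (\<i> * of_real (2 * pi * real i / real H))" by (simp add: rt_def mult_ac)
  thus ?thesis by (simp only: norm_exp_i_times)
qed

lemma rt_power_H: "rt i ^ H = 1"
  unfolding rt_def using H_pos by (intro complex_root_unity) auto

text \<open>Reducing the discrete logarithm modulo \<open>H = (p - 1) / 2\<close> rather than \<open>p - 1\<close> makes these
  characters even.\<close>

definition psi :: "int \<Rightarrow> complex" where "psi a = rt (dlog a)"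

definition char :: "nat \<Rightarrow> int \<Rightarrow> complex" where
  "char j a = (if coprime a (int p) then psi a ^ j else 0)"

lemma psi_eq:
  assumes "[a = int (g ^ i)] (mod int p)"
  shows "psi a = rt i" "coprime a (int p)"
proof -
  have "coprime (int (g ^ i)) (int p)"
    using coprime_g by (simp add: coprime_commute)
  thus cop: "coprime a (int p)" using assms cong_imp_coprime cong_sym by blast
  have "[int (g ^ dlog a) = int (g ^ i)] (mod int p)"
    using dlog[OF cop] assms cong_sym cong_trans by blast
  hence "[g ^ dlog a = g ^ i] (mod p)" by (simp only: cong_int_iff)
  hence "[dlog a = i] (mod 2 * H)" using power_g_cong by simp
  hence "[dlog a = i] (mod H)" by (metis cong_modulus_mult_nat mult.commute)
  thus "psi a = rt i" by (simp add: psi_def rt_eq_iff)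
qed

lemma psi_mult:
  assumes "coprime a (int p)" "coprime b (int p)"
  shows "psi (a * b) = psi a * psi b"
proof -
  have "[a * b = int (g ^ dlog a) * int (g ^ dlog b)] (mod int p)"
    using dlog assms by (intro cong_mult) auto
  hence "[a * b = int (g ^ (dlog a + dlog b))] (mod int p)" by (simp add: power_add)
  from psi_eq(1)[OF this] show ?thesis by (simp add: rt_add psi_def)
qed

lemma psi_cong:
  assumes "[a = b] (mod int p)" "coprime b (int p)"
  shows "psi a = psi b"
  using psi_eq(1)[OF cong_trans[OF assms(1) dlog[OF assms(2)]]] by (simp add: psi_def)

text \<open>Equality of logarithms modulo \<open>H\<close> means equality of their doubles modulo
  \<open>2 * H\<close>, that is, of the squares of \<open>a\<close> and \<open>b\<close> modulo
  \<open>p\<close>.\<close>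

lemma psi_eq_iff:
  assumes "coprime a (int p)" "coprime b (int p)"
  shows "psi a = psi b \<longleftrightarrow> int p dvd (a - b) \<or> int p dvd (a + b)"
proof -
  let ?i = "dlog a" and ?j = "dlog b"
  have "psi a = psi b \<longleftrightarrow> [?i = ?j] (mod H)" by (simp add: psi_def rt_eq_iff)
  also have "\<dots> \<longleftrightarrow> [2 * ?i = 2 * ?j] (mod 2 * H)"
    by (simp add: cong_def mod_mult_mult1)
  also have "\<dots> \<longleftrightarrow> [int (g ^ (2 * ?i)) = int (g ^ (2 * ?j))] (mod int p)"
    unfolding power_g_cong[symmetric] by (simp only: cong_int_iff)
  also have "\<dots> \<longleftrightarrow> [int (g ^ ?i) * int (g ^ ?i) = int (g ^ ?j) * int (g ^ ?j)] (mod int p)"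
    by (simp add: mult_2 power_add)
  also have "\<dots> \<longleftrightarrow> [a * a = b * b] (mod int p)"
    using cong_mult[OF dlog[OF assms(1)] dlog[OF assms(1)]] cong_mult[OF dlog[OF assms(2)] dlog[OF assms(2)]]
    by (metis cong_sym cong_trans)
  also have "\<dots> \<longleftrightarrow> int p dvd (a - b) * (a + b)"
    by (simp add: cong_iff_dvd_diff algebra_simps)
  also have "\<dots> \<longleftrightarrow> int p dvd (a - b) \<or> int p dvd (a + b)"
    using prime_p by (simp add: prime_dvd_mult_iff)
  finally show ?thesis .
qed

lemma norm_psi: "norm (psi a) = 1"
  by (simp add: psi_def norm_rt)

lemma norm_char_le: "norm (char j a) \<le> 1"
  by (simp add: char_def norm_power norm_psi)

lemma psi_one: "psi 1 = 1"
  using psi_eq(1)[of 1 0] rt_eq_1_iff[of 0] by simp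

lemma char_mult: "char j (a * b) = char j a * char j b"
  by (simp add: char_def psi_mult power_mult_distrib)

lemma char_even: "char j \<in> even_characters p"
proof -
  have p0: "coprime (1::int) (int p)" "coprime (-1::int) (int p)" by simp_all
  have "psi (-1) = psi 1" using psi_eq_iff[OF p0(2,1)] by simp
  hence "char j (-1) = 1" by (simp add: char_def psi_one)
  moreover have "char j (a + int p) = char j a" for a
  proof -
    have cop: "coprime (a + int p) (int p) \<longleftrightarrow> coprime a (int p)"
      by (simp add: coprime_iff)
    have "[a + int p = a] (mod int p)" by (simp add: cong_def)
    thus ?thesis using psi_cong[of "a + int p" a] by (simp add: char_def cop)
  qed
  moreover have "char j a \<noteq> 0 \<longleftrightarrow> coprime a (int p)" for a
    using norm_psi[of a] by (auto simp: char_def)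
  ultimately show ?thesis
    using char_mult by (simp add: even_characters_def dirichlet_character_def)
qed

text \<open>The values at the primitive root \<open>g\<close> are distinct H-th roots of
  unity.\<close>

lemma inj_char: "inj_on char {..<H}"
proof (rule inj_onI)
  fix i j assume ij: "i \<in> {..<H}" "j \<in> {..<H}" "char i = char j"
  have "[int g = int (g ^ 1)] (mod int p)" by simp
  note * = psi_eq[OF this]
  have pow: "rt 1 ^ j = rt j" for j
  proof (induction j)
    case 0
    show ?case using rt_eq_1_iff[of 0] by simp
  next
    case (Suc j)
    thus ?case using rt_add[of 1 j] by simp
  qed
  have "char i (int g) = char j (int g)" using ij by simp
  hence "rt i = rt j" using * by (simp add: char_def pow[unfolded One_nat_def])
  thus "i = j" using ij by (auto simp: rt_eq_iff cong_def)
qed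

text \<open>A character is determined by its value at \<open>g\<close>, a root of unity of order
  dividing \<open>2 * H\<close>. Finiteness rules out the default value 0 of \<open>card\<close>
  when characters are counted.\<close>

lemma finite_even_characters: "finite (even_characters p)"
proof (rule finite_imageD)
  let ?f = "\<lambda>chi :: int \<Rightarrow> complex. chi (int g)"
  have basic: "chi (int g ^ n) = chi (int g) ^ n" "chi (a + int p * int n) = chi a" "chi 1 = 1"
    if "chi \<in> even_characters p" for chi n a
  proof -
    have mult: "chi (a * b) = chi a * chi b" and per: "chi (a + int p) = chi a"
      and nz: "chi a \<noteq> 0 \<longleftrightarrow> coprime a (int p)" for a b
      using that by (auto simp: even_characters_def dirichlet_character_def)
    have "chi 1 * chi 1 = chi 1" using mult[of 1 1] by simp
    thus one: "chi 1 = 1" using nz[of 1] by simp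
    show "chi (int g ^ n) = chi (int g) ^ n" by (induction n) (simp_all add: one mult)
    show "chi (a + int p * int n) = chi a"
    proof (induction n)
      case (Suc n)
      thus ?case using per[of "a + int p * int n"] by (simp add: algebra_simps)
    qed simp
  qed
  have cong: "chi a = chi b" if chi: "chi \<in> even_characters p" and ab: "[a = b] (mod int p)" for chi a b
  proof -
    obtain k where k: "a = b + int p * k" using ab by (metis cong_iff_lin cong_sym mult.commute)
    show ?thesis
    proof (cases "k \<ge> 0")
      case True
      thus ?thesis using basic(2)[OF chi, of b "nat k"] k by simp
    next
      case False
      thus ?thesis using basic(2)[OF chi, of a "nat (- k)"] k by simp
    qed
  qed
  show "finite (?f ` even_characters p)"
  proof (rule finite_subset)
    show "?f ` even_characters p \<subseteq> {z. z ^ (2 * H) = 1}"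
    proof clarify
      fix chi assume chi: "chi \<in> even_characters p"
      have "[g ^ (2 * H) = g ^ 0] (mod p)" unfolding power_g_cong by (simp add: cong_def)
      hence "[int (g ^ (2 * H)) = 1] (mod int p)" using cong_int_iff[of "g ^ (2 * H)" 1 p] by simp
      hence "chi (int (g ^ (2 * H))) = chi 1" by (rule cong[OF chi])
      thus "chi (int g) ^ (2 * H) = 1" using basic[OF chi] by simp
    qed
    show "finite {z :: complex. z ^ (2 * H) = 1}" using H_pos by (intro finite_roots_unity) auto
  qed
  show "inj_on ?f (even_characters p)"
  proof (rule inj_onI, rule ext)
    fix chi chi' a assume c: "chi \<in> even_characters p" "chi' \<in> even_characters p" "chi (int g) = chi' (int g)"
    show "chi a = chi' a"
    proof (cases "coprime a (int p)")
      case True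
      have "chi a = chi (int g ^ dlog a)" "chi' a = chi' (int g ^ dlog a)"
        using cong[OF c(1) dlog[OF True]] cong[OF c(2) dlog[OF True]] by simp_all
      thus ?thesis using c(3) basic(1)[OF c(1)] basic(1)[OF c(2)] by simp
    next
      case False
      thus ?thesis using c(1,2) unfolding even_characters_def dirichlet_character_def by auto
    qed
  qed
qed

section \<open>Orthogonality of even characters\<close>

text \<open>Congruence up to sign between units is all that even characters can detect; coprimality
  of \<open>b\<close> is implied.\<close>

definition eqv :: "int \<Rightarrow> int \<Rightarrow> bool" where
  "eqv a b \<longleftrightarrow> coprime a (int p) \<and> (int p dvd (a - b) \<or> int p dvd (a + b))"

text \<open>A geometric series in \<open>z\<close>, which is an H-th root of unity.\<close>

lemma char_orthogonality: "(\<Sum>j<H. char j a * cnj (char j b)) = (if eqv a b then of_nat H else 0)"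
proof (cases "coprime a (int p) \<and> coprime b (int p)")
  case False
  moreover have "\<not> eqv a b"
  proof
    assume e: "eqv a b"
    hence a: "coprime a (int p)" by (simp add: eqv_def)
    hence "int p dvd b" using False coprime_iff[of b] by simp
    hence "int p dvd a" using e unfolding eqv_def by (auto simp: dvd_add_left_iff dvd_diff_left_iff)
    thus False using a coprime_iff by simp
  qed
  ultimately show ?thesis by (auto simp: char_def)
next
  case True
  define z where "z = psi a * cnj (psi b)"
  have "psi b * cnj (psi b) = 1"
    using complex_norm_square[of "psi b"] norm_psi[of b] by simp
  hence z1: "z = 1 \<longleftrightarrow> psi a = psi b"
    unfolding z_def by (metis mult.assoc mult.commute mult_1)
  have zH: "z ^ H = 1" unfolding z_def psi_def
    by (simp add: power_mult_distrib rt_power_H flip: complex_cnj_power)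
  have "(\<Sum>j<H. char j a * cnj (char j b)) = (\<Sum>j<H. z ^ j)"
    using True by (simp add: char_def z_def power_mult_distrib)
  also have "\<dots> = (if z = 1 then of_nat H else 0)"
    using zH by (auto simp: sum_gp_strict)
  also have "z = 1 \<longleftrightarrow> eqv a b"
    using z1 psi_eq_iff[of a b] True by (simp add: eqv_def)
  finally show ?thesis .
qed

text \<open>The common source of all averages below: theta against the mollifier, and the second
  moments of theta and of the squared mollifier.\<close>

lemma char_bilinear:
  fixes c :: "'i \<Rightarrow> real" and d :: "'l \<Rightarrow> real"
  shows "(\<Sum>j<H. (\<Sum>i\<in>I. of_real (c i) * char j (a i)) * cnj (\<Sum>l\<in>I'. of_real (d l) * char j (b l)))
    = of_real (real H * (\<Sum>i\<in>I. \<Sum>l\<in>I'. if eqv (a i) (b l) then c i * d l else 0))"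
proof -
  have "(\<Sum>j<H. (\<Sum>i\<in>I. of_real (c i) * char j (a i)) * cnj (\<Sum>l\<in>I'. of_real (d l) * char j (b l)))
    = (\<Sum>j<H. \<Sum>i\<in>I. \<Sum>l\<in>I'. of_real (c i * d l) * (char j (a i) * cnj (char j (b l))))"
    by (simp add: sum_product mult_ac)
  also have "\<dots> = (\<Sum>i\<in>I. \<Sum>l\<in>I'. \<Sum>j<H. of_real (c i * d l) * (char j (a i) * cnj (char j (b l))))"
    by (subst sum.swap) (intro sum.cong refl sum.swap)
  also have "\<dots> = (\<Sum>i\<in>I. \<Sum>l\<in>I'. of_real (c i * d l) * (if eqv (a i) (b l) then of_nat H else 0))"
    by (simp only: sum_distrib_left[symmetric] char_orthogonality)
  also have "\<dots> = of_real (real H * (\<Sum>i\<in>I. \<Sum>l\<in>I'. if eqv (a i) (b l) then c i * d l else 0))"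
    unfolding sum_distrib_left of_real_sum by (intro sum.cong refl) simp
  finally show ?thesis .
qed

lemma char_second_moment:
  fixes c :: "'i \<Rightarrow> real"
  shows "(\<Sum>j<H. (norm (\<Sum>i\<in>I. of_real (c i) * char j (a i)))\<^sup>2)
    = real H * (\<Sum>i\<in>I. \<Sum>l\<in>I. if eqv (a i) (a l) then c i * c l else 0)"
proof -
  have "complex_of_real (\<Sum>j<H. (norm (\<Sum>i\<in>I. of_real (c i) * char j (a i)))\<^sup>2) =
     (\<Sum>j<H. (\<Sum>i\<in>I. of_real (c i) * char j (a i)) * cnj (\<Sum>i\<in>I. of_real (c i) * char j (a i)))"
    unfolding of_real_sum by (intro sum.cong refl complex_norm_square)
  also have "\<dots> = of_real (real H * (\<Sum>i\<in>I. \<Sum>l\<in>I. if eqv (a i) (a l) then c i * c l else 0))"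
    by (rule char_bilinear)
  finally show ?thesis by (simp only: of_real_eq_iff)
qed

end

section \<open>Moments of theta values\<close>

text \<open>The indices are cut into blocks of length \<open>s\<close>. In block \<open>k\<close>
  the Gaussian is at most \<open>\<rho> ^ k\<close>, because (s k)^2 / p \<ge> k^2 \<ge> k. The
  lemma serves both the full sum, with \<open>s\<close> about the square root of \<open>p\<close>,
  and the sum over residues, with \<open>s = p\<close>.\<close>

lemma sum_gaussian_le:
  fixes x :: real and c :: nat
  assumes "x > 0" "p > 0" "real p \<le> (real s)\<^sup>2" "finite A"
    and "\<And>k. card {n\<in>A. n div s = k} \<le> c"
  shows "(\<Sum>n\<in>A. exp (- pi * (real (Suc n))\<^sup>2 * x / real p)) \<le> real c / (1 - exp (- pi * x))"
proof -
  define \<rho> where "\<rho> = exp (- pi * x)"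
  have \<rho>: "0 < \<rho>" "\<rho> < 1" using assms(1) by (auto simp: \<rho>_def)
  have gauss_le: "exp (- pi * (real (Suc n))\<^sup>2 * x / real p) \<le> \<rho> ^ (n div s)" for n
  proof -
    define k where "k = n div s"
    have "s * k \<le> Suc n" unfolding k_def by (metis le_SucI times_div_less_eq_dividend)
    hence "real s * real k \<le> real (Suc n)" by (metis of_nat_le_iff of_nat_mult)
    hence "(real s * real k)\<^sup>2 \<le> (real (Suc n))\<^sup>2" by (intro power_mono) auto
    moreover have "real p * (real k)\<^sup>2 \<le> (real s * real k)\<^sup>2"
      using assms(3) by (simp add: power_mult_distrib mult_right_mono)
    moreover have "real p * real k \<le> real p * (real k)\<^sup>2"
      by (cases k) (auto simp: power2_eq_square algebra_simps intro!: mult_left_mono)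
    ultimately have "real p * real k \<le> (real (Suc n))\<^sup>2" by linarith
    hence "real k \<le> (real (Suc n))\<^sup>2 / real p" using assms(2) by (simp add: field_simps)
    hence "pi * x * real k \<le> pi * x * ((real (Suc n))\<^sup>2 / real p)"
      using assms(1) by (intro mult_left_mono) auto
    hence "exp (- pi * (real (Suc n))\<^sup>2 * x / real p) \<le> exp (real k * (- pi * x))"
      by (simp add: mult_ac)
    also have "\<dots> = \<rho> ^ k" unfolding \<rho>_def by (rule exp_of_nat_mult)
    finally show ?thesis by (simp only: k_def)
  qed
  have "(\<Sum>n\<in>A. exp (- pi * (real (Suc n))\<^sup>2 * x / real p)) \<le> (\<Sum>n\<in>A. \<rho> ^ (n div s))"
    by (intro sum_mono gauss_le)
  also have "\<dots> = (\<Sum>k\<in>(\<lambda>n. n div s) ` A. \<Sum>n | n \<in> A \<and> n div s = k. \<rho> ^ (n div s))"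
    using assms(4) by (intro sum.group[symmetric]) auto
  also have "\<dots> = (\<Sum>k\<in>(\<lambda>n. n div s) ` A. real (card {n\<in>A. n div s = k}) * \<rho> ^ k)"
    by (intro sum.cong refl) simp
  also have "\<dots> \<le> (\<Sum>k\<in>(\<lambda>n. n div s) ` A. real c * \<rho> ^ k)"
    using assms(5) \<rho> by (intro sum_mono mult_right_mono) auto
  also have "\<dots> = real c * (\<Sum>k\<in>(\<lambda>n. n div s) ` A. \<rho> ^ k)" by (simp add: sum_distrib_left)
  also have "\<dots> \<le> real c * (\<Sum>k. \<rho> ^ k)"
    using assms(4) \<rho> by (intro mult_left_mono sum_le_suminf summable_geometric) auto
  also have "\<dots> = real c / (1 - \<rho>)" using \<rho> by (simp add: suminf_geometric)
  finally show ?thesis by (simp add: \<rho>_def)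
qed

context odd_prime_primroot
begin

definition gauss :: "real \<Rightarrow> nat \<Rightarrow> real" where
  "gauss x n = exp (- pi * (real (Suc n))\<^sup>2 * x / real p)"

text \<open>Truncation makes the interchange of sums in the orthogonality relation finite; the limit
  is taken only in the resulting inequalities.\<close>

definition theta_part :: "real \<Rightarrow> nat \<Rightarrow> nat \<Rightarrow> complex" where
  "theta_part x R j = (\<Sum>n<R. of_real (gauss x n) * char j (int (Suc n)))"

lemma sum_gauss_le:
  assumes "x > 0"
  shows "(\<Sum>n<R. gauss x n) \<le> 2 * sqrt (real p) / (1 - exp (- pi * x))"
proof -
  define s where "s = nat \<lceil>sqrt (real p)\<rceil>"
  have sp: "sqrt (real p) \<ge> 1" using p_gt_2 by simp
  have s: "sqrt (real p) \<le> real s" "real s \<le> sqrt (real p) + 1"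
    unfolding s_def using sp by linarith+
  have "(sqrt (real p))\<^sup>2 \<le> (real s)\<^sup>2" using s sp by (intro power_mono) auto
  hence ps: "real p \<le> (real s)\<^sup>2" by simp
  have s0: "s > 0" using s sp by linarith
  have "(\<Sum>n<R. gauss x n) \<le> real s / (1 - exp (- pi * x))"
    unfolding gauss_def
  proof (rule sum_gaussian_le[OF assms _ ps])
    fix k
    have "{n\<in>{..<R}. n div s = k} \<subseteq> {k * s..<k * s + s}"
      using s0 by (auto simp: div_nat_eqI dividend_less_div_times add.commute)
    hence "card {n\<in>{..<R}. n div s = k} \<le> card {k * s..<k * s + s}" by (intro card_mono) auto
    thus "card {n\<in>{..<R}. n div s = k} \<le> s" by simp
  qed (use p_gt_2 in auto)
  also have "\<dots> \<le> 2 * sqrt (real p) / (1 - exp (- pi * x))"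
  proof (rule divide_right_mono)
    show "real s \<le> 2 * sqrt (real p)" using s sp by linarith
  qed (use assms in simp)
  finally show ?thesis .
qed

text \<open>Only the residue classes of \<open>m\<close> and \<open>- m\<close> contribute, so each
  block of length \<open>p\<close> holds at most two terms.\<close>

lemma sum_gauss_eqv_le:
  assumes "x > 0"
  shows "(\<Sum>n<R. if eqv m (int (Suc n)) then gauss x n else 0) \<le> 2 / (1 - exp (- pi * x))"
proof -
  let ?A = "{n\<in>{..<R}. eqv m (int (Suc n))}"
  have p0: "p > 0" using p_gt_2 by simp
  have "(\<Sum>n<R. if eqv m (int (Suc n)) then gauss x n else 0) = (\<Sum>n\<in>?A. gauss x n)"
    by (rule sum.inter_filter[symmetric]) simp
  also have "\<dots> \<le> real 2 / (1 - exp (- pi * x))"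
    unfolding gauss_def
  proof (rule sum_gaussian_le[OF assms])
    have "real p * 1 \<le> real p * real p" using p0 by (intro mult_left_mono) auto
    thus "real p \<le> (real p)\<^sup>2" by (simp add: power2_eq_square)
    fix k
    let ?B = "{n\<in>?A. n div p = k}"
    \<comment> \<open>The shift by 1 arises because index \<open>n\<close> stands for the summand at
      \<open>n + 1\<close>.\<close>
    let ?res = "{nat ((m - 1) mod int p), nat ((- m - 1) mod int p)}"
    have "card ?B \<le> card ?res"
    proof (rule card_inj_on_le[of "\<lambda>n. n mod p"])
      show "inj_on (\<lambda>n. n mod p) ?B"
        by (rule inj_onI) (metis (mono_tags, lifting) mem_Collect_eq mult_div_mod_eq)
      show "(\<lambda>n. n mod p) ` ?B \<subseteq> ?res"
      proof
        fix r assume "r \<in> (\<lambda>n. n mod p) ` ?B"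
        then obtain n where n: "r = n mod p" "eqv m (int (Suc n))" by auto
        hence r: "r = nat (int n mod int p)" by (simp add: nat_mod_as_int)
        have "int p dvd (m - int (Suc n)) \<or> int p dvd (m + int (Suc n))"
          using n by (simp add: eqv_def)
        thus "r \<in> ?res"
        proof
          assume "int p dvd (m - int (Suc n))"
          hence "int p dvd ((m - 1) - int n)" by (simp add: algebra_simps)
          hence "(m - 1) mod int p = int n mod int p" by (simp add: mod_eq_dvd_iff)
          thus ?thesis using r by simp
        next
          assume "int p dvd (m + int (Suc n))"
          hence "int p dvd (- (int n - (- m - 1)))"
            by (subst dvd_minus_iff) (simp add: algebra_simps)
          hence "int n mod int p = (- m - 1) mod int p"
            unfolding mod_eq_dvd_iff by (subst (asm) dvd_minus_iff)
          thus ?thesis using r by simp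
        qed
      qed
    qed simp
    also have "\<dots> \<le> 2" by (simp add: card_insert_if)
    finally show "card ?B \<le> 2" .
  qed (use p0 in auto)
  finally show ?thesis by simp
qed

lemma theta_part_second_moment:
  assumes "x > 0"
  shows "(\<Sum>j<H. (norm (theta_part x R j))\<^sup>2) \<le> real H * (4 / (1 - exp (- pi * x))\<^sup>2 * sqrt (real p))"
proof -
  let ?d = "1 - exp (- pi * x)"
  have d: "?d > 0" using assms by simp
  have "(\<Sum>j<H. (norm (theta_part x R j))\<^sup>2) = real H * (\<Sum>n<R. \<Sum>l<R.
      if eqv (int (Suc n)) (int (Suc l)) then gauss x n * gauss x l else 0)"
    unfolding theta_part_def by (rule char_second_moment)
  also have "\<dots> = real H * (\<Sum>n<R. gauss x n * (\<Sum>l<R. if eqv (int (Suc n)) (int (Suc l)) then gauss x l else 0))"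
    unfolding sum_distrib_left by (intro sum.cong refl) simp
  also have "\<dots> \<le> real H * (\<Sum>n<R. gauss x n * (2 / ?d))"
    by (intro mult_left_mono sum_mono sum_gauss_eqv_le assms) (auto simp: gauss_def)
  also have "\<dots> = real H * ((2 / ?d) * (\<Sum>n<R. gauss x n))"
    by (simp only: sum_distrib_right[symmetric] mult.commute)
  also have "\<dots> \<le> real H * ((2 / ?d) * (2 * sqrt (real p) / ?d))"
    using d by (intro mult_left_mono sum_gauss_le assms) auto
  also have "\<dots> = real H * (4 / ?d\<^sup>2 * sqrt (real p))" by (simp add: power2_eq_square)
  finally show ?thesis .
qed

lemma theta_part_tendsto:
  assumes "x > 0"
  shows "(\<lambda>R. theta_part x R j) \<longlonglongrightarrow> theta p x (char j)"
proof -
  have "summable (gauss x)"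
    by (rule summableI_nonneg_bounded[OF _ sum_gauss_le[OF assms]]) (simp add: gauss_def)
  hence "summable (\<lambda>n. of_real (gauss x n) * char j (int (Suc n)))"
  proof (rule summable_comparison_test'[where N = 0])
    fix n
    have "gauss x n * norm (char j (int (Suc n))) \<le> gauss x n * 1"
      by (intro mult_left_mono norm_char_le) (simp add: gauss_def)
    thus "norm (of_real (gauss x n) * char j (int (Suc n))) \<le> gauss x n"
      by (simp add: norm_mult gauss_def)
  qed
  hence "(\<lambda>R. \<Sum>n<R. of_real (gauss x n) * char j (int (Suc n))) \<longlonglongrightarrow>
     (\<Sum>n. of_real (gauss x n) * char j (int (Suc n)))"
    by (rule summable_LIMSEQ)
  thus ?thesis unfolding theta_part_def theta_def gauss_def by (simp only: mult.commute)
qed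

lemma theta_second_moment:
  assumes "x > 0"
  shows "(\<Sum>j<H. (norm (theta p x (char j)))\<^sup>2) \<le> real H * (4 / (1 - exp (- pi * x))\<^sup>2 * sqrt (real p))"
proof (rule LIMSEQ_le_const2)
  show "(\<lambda>R. \<Sum>j<H. (norm (theta_part x R j))\<^sup>2) \<longlonglongrightarrow> (\<Sum>j<H. (norm (theta p x (char j)))\<^sup>2)"
    by (intro tendsto_sum tendsto_power tendsto_norm theta_part_tendsto assms)
qed (use theta_part_second_moment[OF assms] in blast)

section \<open>Moments involving the mollifier\<close>

text \<open>Products of two integers up to this level are at most p / 3, so the sum of two such
  products stays below \<open>p\<close>.\<close>

definition level :: real where "level = sqrt (real p / 3)"

definition mollifier :: "(nat \<Rightarrow> real) \<Rightarrow> nat \<Rightarrow> complex" where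
  "mollifier w j = (\<Sum>m\<in>pos_upto level. of_real (w m) * char j (int m))"

lemma pos_upto_level: "m \<in> pos_upto level \<Longrightarrow> m \<ge> 1 \<and> 3 * (real m)\<^sup>2 \<le> real p"
proof -
  assume "m \<in> pos_upto level"
  hence m: "m \<ge> 1" "real m \<le> sqrt (real p / 3)" by (auto simp: pos_upto_def level_def)
  have "(real m)\<^sup>2 \<le> (sqrt (real p / 3))\<^sup>2" using m by (intro power_mono) auto
  thus ?thesis using m by simp
qed

lemma mult_pos_upto_level:
  assumes "m \<in> pos_upto level" "n \<in> pos_upto level"
  shows "3 * (m * n) \<le> p" "m * n > 0"
proof -
  have mn: "m \<ge> 1" "n \<ge> 1" "3 * (real m)\<^sup>2 \<le> real p" "3 * (real n)\<^sup>2 \<le> real p"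
    using pos_upto_level assms by auto
  have "2 * (real m * real n) \<le> (real m)\<^sup>2 + (real n)\<^sup>2"
    using sum_squares_bound[of "real m" "real n"] by (simp add: mult.assoc)
  hence "real (3 * (m * n)) \<le> real p" using mn by simp
  thus "3 * (m * n) \<le> p" by (simp only: of_nat_le_iff)
  show "m * n > 0" using mn by simp
qed

text \<open>After orthogonality all terms are nonnegative, so the diagonal may be kept alone; there
  m^2 / p \<le> 1 / 3 bounds the Gaussian from below.\<close>

lemma theta_mollifier_ge:
  assumes "x > 0" "admissible_weight level w"
  shows "norm (\<Sum>j<H. theta p x (char j) * cnj (mollifier w j)) \<ge>
    real H * (exp (- pi * x / 3) * weight_norm level w)"
proof (rule LIMSEQ_le_const)
  show "(\<lambda>R. norm (\<Sum>j<H. theta_part x R j * cnj (mollifier w j))) \<longlonglongrightarrow>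
     norm (\<Sum>j<H. theta p x (char j) * cnj (mollifier w j))"
    by (intro tendsto_norm tendsto_sum tendsto_mult_right theta_part_tendsto assms)
  have w: "w m \<ge> 0" if "m \<in> pos_upto level" for m
    using assms(2) that by (simp add: admissible_weight_def)
  show "\<exists>R0. \<forall>R\<ge>R0. real H * (exp (- pi * x / 3) * weight_norm level w) \<le>
      norm (\<Sum>j<H. theta_part x R j * cnj (mollifier w j))"
  proof (intro exI allI impI)
    \<comment> \<open>From \<open>R = p\<close> on, the truncated sum contains every diagonal
      term.\<close>
    fix R assume R: "p \<le> R"
    define s where "s = (\<Sum>n<R. \<Sum>m\<in>pos_upto level. if eqv (int (Suc n)) (int m) then gauss x n * w m else 0)"
    have "exp (- pi * x / 3) * weight_norm level w = (\<Sum>m\<in>pos_upto level. exp (- pi * x / 3) * w m)"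
      by (simp add: weight_norm_def sum_distrib_left)
    also have "\<dots> \<le> (\<Sum>m\<in>pos_upto level. \<Sum>n<R. if eqv (int (Suc n)) (int m) then gauss x n * w m else 0)"
    proof (rule sum_mono)
      fix m assume m: "m \<in> pos_upto level"
      hence m1: "m \<ge> 1" "3 * (real m)\<^sup>2 \<le> real p" using pos_upto_level by auto
      have m3: "3 * (m * m) \<le> p" using mult_pos_upto_level[OF m m] by simp
      have "m * 1 \<le> m * m" using m1 by (intro mult_le_mono2)
      hence mp: "m < p" "m - 1 < R" using m3 m1 R by linarith+
      have "(real m)\<^sup>2 / real p \<le> 1 / 3" using m1 p_gt_2 by (simp add: field_simps)
      hence "pi * x * ((real m)\<^sup>2 / real p) \<le> pi * x * (1 / 3)"
        using assms(1) by (intro mult_left_mono) auto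
      \<comment> \<open>The diagonal term of \<open>m\<close> has index
        \<open>m - 1\<close>.\<close>
      hence "exp (- pi * x / 3) \<le> gauss x (m - 1)"
        using m1 by (simp add: gauss_def mult_ac)
      moreover have "eqv (int m) (int m)"
        using m1 mp by (auto simp: eqv_def coprime_iff dest!: zdvd_imp_le)
      ultimately have "exp (- pi * x / 3) * w m \<le>
         (\<Sum>n\<in>{m - 1}. if eqv (int (Suc n)) (int m) then gauss x n * w m else 0)"
        using m1 w[OF m] by (simp add: mult_right_mono)
      also have "\<dots> \<le> (\<Sum>n<R. if eqv (int (Suc n)) (int m) then gauss x n * w m else 0)"
        using mp w[OF m] by (intro sum_mono2) (auto simp: gauss_def)
      finally show "exp (- pi * x / 3) * w m \<le> \<dots>" .
    qed
    also have "\<dots> = s" unfolding s_def by (rule sum.swap)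
    finally have le: "exp (- pi * x / 3) * weight_norm level w \<le> s" .
    have "(\<Sum>j<H. theta_part x R j * cnj (mollifier w j)) = of_real (real H * s)"
      unfolding theta_part_def mollifier_def s_def by (rule char_bilinear)
    hence "norm (\<Sum>j<H. theta_part x R j * cnj (mollifier w j)) = \<bar>real H * s\<bar>"
      by (simp only: norm_of_real)
    moreover have "real H * (exp (- pi * x / 3) * weight_norm level w) \<le> real H * s"
      using le by (intro mult_left_mono) auto
    ultimately show "real H * (exp (- pi * x / 3) * weight_norm level w) \<le>
      norm (\<Sum>j<H. theta_part x R j * cnj (mollifier w j))" by linarith
  qed
qed

text \<open>The squared mollifier is again a character sum, now over products, and has a second
  moment of the form already computed.\<close>

lemma mollifier_fourth_moment:
  assumes "admissible_weight level w"
  shows "(\<Sum>j<H. (norm (mollifier w j)) ^ 4) \<le> real H * weighted_energy level w"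
proof -
  let ?U = "pos_upto level"
  have w: "w m \<ge> 0" if "m \<in> ?U" for m
    using assms that by (simp add: admissible_weight_def)
  have sq: "(mollifier w j)\<^sup>2 = (\<Sum>a\<in>?U \<times> ?U. of_real (w (fst a) * w (snd a)) * char j (int (fst a * snd a)))" for j
    unfolding mollifier_def power2_eq_square sum_product sum.cartesian_product
    by (intro sum.cong refl) (auto simp: char_mult mult_ac)
  have "(\<Sum>j<H. (norm (mollifier w j)) ^ 4) = (\<Sum>j<H. (norm ((mollifier w j)\<^sup>2))\<^sup>2)"
    by (simp add: norm_power)
  also have "\<dots> = real H * (\<Sum>a\<in>?U \<times> ?U. \<Sum>b\<in>?U \<times> ?U.
      if eqv (int (fst a * snd a)) (int (fst b * snd b)) then (w (fst a) * w (snd a)) * (w (fst b) * w (snd b)) else 0)"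
    unfolding sq by (rule char_second_moment)
  also have "\<dots> \<le> real H * (\<Sum>a\<in>?U \<times> ?U. \<Sum>b\<in>?U \<times> ?U.
      if fst a * snd a = fst b * snd b then (w (fst a) * w (snd a)) * (w (fst b) * w (snd b)) else 0)"
  proof (intro mult_left_mono sum_mono)
    fix a b assume ab: "a \<in> ?U \<times> ?U" "b \<in> ?U \<times> ?U"
    let ?m = "fst a * snd a" and ?n = "fst b * snd b"
    have bd: "3 * ?m \<le> p" "3 * ?n \<le> p" "?m > 0" "?n > 0"
      using mult_pos_upto_level[of "fst a" "snd a"] mult_pos_upto_level[of "fst b" "snd b"] ab by auto
    have "?m = ?n" if "eqv (int ?m) (int ?n)"
    proof -
      \<comment> \<open>The sum lies strictly between 0 and \<open>p\<close>, which excludes the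
        sign -1; the difference is smaller than \<open>p\<close> in absolute value and must
        vanish.\<close>
      have "int ?m + int ?n > 0" "int ?m + int ?n < int p" using bd by linarith+
      hence "\<not> int p dvd int ?m + int ?n" using zdvd_imp_le by fastforce
      hence dvd: "int p dvd int ?m - int ?n" using that unfolding eqv_def by blast
      have "\<bar>int ?m - int ?n\<bar> < int p" using bd by linarith
      hence "int ?m - int ?n = 0" using dvd_imp_le_int[OF _ dvd] by linarith
      thus ?thesis by linarith
    qed
    thus "(if eqv (int ?m) (int ?n) then (w (fst a) * w (snd a)) * (w (fst b) * w (snd b)) else 0) \<le>
      (if ?m = ?n then (w (fst a) * w (snd a)) * (w (fst b) * w (snd b)) else 0)"
      using w ab by (auto intro!: mult_nonneg_nonneg)
  qed simp
  also have "(\<Sum>a\<in>?U \<times> ?U. \<Sum>b\<in>?U \<times> ?U.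
      if fst a * snd a = fst b * snd b then (w (fst a) * w (snd a)) * (w (fst b) * w (snd b)) else 0) =
      (\<Sum>c\<in>(?U \<times> ?U) \<times> (?U \<times> ?U). if fst (fst c) * snd (fst c) = fst (snd c) * snd (snd c)
         then (w (fst (fst c)) * w (snd (fst c))) * (w (fst (snd c)) * w (snd (snd c))) else 0)"
    by (simp add: sum.cartesian_product case_prod_unfold)
  also have "\<dots> = (\<Sum>c | c \<in> (?U \<times> ?U) \<times> (?U \<times> ?U) \<and> fst (fst c) * snd (fst c) = fst (snd c) * snd (snd c).
      (w (fst (fst c)) * w (snd (fst c))) * (w (fst (snd c)) * w (snd (snd c))))"
    by (rule sum.inter_filter[symmetric]) simp
  also have "\<dots> = weighted_energy level w"
    unfolding weighted_energy_def
    by (rule sum.reindex_bij_witness[where i = "\<lambda>(m1, m2, n1, n2). ((m1, m2), (n1, n2))"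
          and j = "\<lambda>((m1, m2), (n1, n2)). (m1, m2, n1, n2)"]) auto
  finally show ?thesis .
qed

text \<open>Hoelder's inequality with exponents 2, 4, 4 on the set \<open>Z\<close> of non-vanishing
  indices, carried out as two applications of Cauchy-Schwarz.\<close>

lemma nonvanishing_times_energy_ge:
  assumes "x > 0" "admissible_weight level w"
  shows "real (card {j\<in>{..<H}. theta p x (char j) \<noteq> 0}) *
     (level\<^sup>2 * weighted_energy level w / weight_norm level w ^ 4) \<ge>
     exp (- pi * x / 3) ^ 4 * (1 - exp (- pi * x)) ^ 4 / 192 * real p"
proof -
  define C where "C = 4 / (1 - exp (- pi * x))\<^sup>2"
  define e where "e = exp (- pi * x / 3)"
  define W where "W = weight_norm level w"
  define En where "En = weighted_energy level w"
  define Z where "Z = {j\<in>{..<H}. theta p x (char j) \<noteq> 0}"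
  define th where "th j = norm (theta p x (char j))" for j
  define M where "M j = norm (mollifier w j)" for j
  have d: "1 - exp (- pi * x) > 0" using assms by simp
  have C: "C > 0" using assms(1) by (simp add: C_def)
  have H0: "real H > 0" using H_pos by simp
  have Z: "finite Z" "Z \<subseteq> {..<H}" by (auto simp: Z_def)
  have W: "W > 0"
  proof -
    obtain m where m: "m \<in> pos_upto level" "w m \<noteq> 0" and nn: "\<forall>m\<in>pos_upto level. w m \<ge> 0"
      using assms(2) by (auto simp: admissible_weight_def)
    have "0 < w m" using m nn by force
    also have "w m \<le> W" unfolding W_def weight_norm_def using m nn by (intro member_le_sum) auto
    finally show ?thesis .
  qed
  have "real H * (e * W) \<le> norm (\<Sum>j<H. theta p x (char j) * cnj (mollifier w j))"
    using theta_mollifier_ge[OF assms] by (simp add: e_def W_def)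
  also have "(\<Sum>j<H. theta p x (char j) * cnj (mollifier w j)) = (\<Sum>j\<in>Z. theta p x (char j) * cnj (mollifier w j))"
    by (rule sum.mono_neutral_right) (auto simp: Z_def)
  also have "norm \<dots> \<le> (\<Sum>j\<in>Z. norm (theta p x (char j) * cnj (mollifier w j)))"
    by (rule norm_sum)
  also have "\<dots> = (\<Sum>j\<in>Z. th j * M j)" by (simp add: norm_mult th_def M_def)
  finally have "(real H * (e * W))\<^sup>2 \<le> (\<Sum>j\<in>Z. th j * M j)\<^sup>2"
    using H0 W by (intro power_mono) (auto simp: e_def)
  also have "\<dots> \<le> (\<Sum>j\<in>Z. (th j)\<^sup>2) * (\<Sum>j\<in>Z. (M j)\<^sup>2)" by (rule Cauchy_Schwarz_ineq_sum)
  also have "\<dots> \<le> (real H * (C * sqrt (real p))) * (\<Sum>j\<in>Z. (M j)\<^sup>2)"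
  proof (rule mult_right_mono)
    have "(\<Sum>j\<in>Z. (th j)\<^sup>2) \<le> (\<Sum>j<H. (th j)\<^sup>2)" using Z by (intro sum_mono2) auto
    also have "\<dots> \<le> real H * (C * sqrt (real p))"
      using theta_second_moment[OF assms(1)] by (simp add: th_def C_def)
    finally show "(\<Sum>j\<in>Z. (th j)\<^sup>2) \<le> real H * (C * sqrt (real p))" .
  qed (auto intro: sum_nonneg)
  finally have 1: "(real H * (e * W))\<^sup>2 \<le> (real H * (C * sqrt (real p))) * (\<Sum>j\<in>Z. (M j)\<^sup>2)" .
  \<comment> \<open>Cauchy-Schwarz against the constant 1 on \<open>Z\<close> brings in its
    cardinality.\<close>
  have "(\<Sum>j\<in>Z. (M j)\<^sup>2)\<^sup>2 = (\<Sum>j\<in>Z. 1 * (M j)\<^sup>2)\<^sup>2" by simp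
  also have "\<dots> \<le> (\<Sum>j\<in>Z. 1\<^sup>2) * (\<Sum>j\<in>Z. ((M j)\<^sup>2)\<^sup>2)" by (rule Cauchy_Schwarz_ineq_sum)
  also have "\<dots> = real (card Z) * (\<Sum>j\<in>Z. M j ^ 4)" by simp
  also have "\<dots> \<le> real (card Z) * (real H * En)"
  proof (rule mult_left_mono)
    have "(\<Sum>j\<in>Z. M j ^ 4) \<le> (\<Sum>j<H. M j ^ 4)" using Z by (intro sum_mono2) auto
    thus "(\<Sum>j\<in>Z. M j ^ 4) \<le> real H * En"
      using mollifier_fourth_moment[OF assms(2)] by (simp add: M_def En_def)
  qed simp
  finally have 2: "(\<Sum>j\<in>Z. (M j)\<^sup>2)\<^sup>2 \<le> real (card Z) * (real H * En)" .
  have "((real H * (e * W))\<^sup>2)\<^sup>2 \<le> ((real H * (C * sqrt (real p))) * (\<Sum>j\<in>Z. (M j)\<^sup>2))\<^sup>2"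
    using 1 by (intro power_mono) auto
  also have "\<dots> = (real H * (C * sqrt (real p)))\<^sup>2 * (\<Sum>j\<in>Z. (M j)\<^sup>2)\<^sup>2" by (rule power_mult_distrib)
  also have "\<dots> \<le> (real H * (C * sqrt (real p)))\<^sup>2 * (real (card Z) * (real H * En))"
    using 2 by (intro mult_left_mono) auto
  also have "\<dots> = real H ^ 3 * (C\<^sup>2 * real p * (real (card Z) * En))"
    by (simp add: power_mult_distrib power2_eq_square power3_eq_cube)
  finally have "real H ^ 3 * (real H * (e ^ 4 * W ^ 4)) \<le> real H ^ 3 * (C\<^sup>2 * real p * (real (card Z) * En))"
    by (simp add: power_mult_distrib power2_eq_square power3_eq_cube power4_eq_xxxx mult_ac)
  hence 3: "real H * (e ^ 4 * W ^ 4) \<le> C\<^sup>2 * real p * (real (card Z) * En)"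
    using H0 by (simp only: mult_le_cancel_left_pos zero_less_power)
  have "real p / 4 \<le> real H" using p_eq H_pos by simp
  hence "real p / 4 * (e ^ 4 * W ^ 4) \<le> real H * (e ^ 4 * W ^ 4)"
    by (rule mult_right_mono) simp
  hence "real p / 4 * (e ^ 4 * W ^ 4) \<le> C\<^sup>2 * real p * (real (card Z) * En)"
    using 3 by linarith
  \<comment> \<open>12 = 4 * 3, with 4 from \<open>p / 4 \<le> H\<close> and 3 from the square of
    \<open>level\<close>; the 16 in \<open>C\<^sup>2\<close> then gives 192.\<close>
  hence "e ^ 4 / (12 * C\<^sup>2) * real p \<le> real (card Z) * (real p / 3 * En / W ^ 4)"
    using W C by (simp add: field_simps)
  also have "real p / 3 = level\<^sup>2" by (simp add: level_def)
  also have "e ^ 4 / (12 * C\<^sup>2) = e ^ 4 * (1 - exp (- pi * x)) ^ 4 / 192"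
    using assms(1) by (simp add: C_def power_divide)
  finally show ?thesis by (simp only: e_def W_def En_def Z_def)
qed

lemma card_nonvanishing_le:
  "card {j\<in>{..<H}. theta p x (char j) \<noteq> 0} \<le> card {chi \<in> even_characters p. theta p x chi \<noteq> 0}"
proof (rule card_inj_on_le[of char])
  show "inj_on char {j\<in>{..<H}. theta p x (char j) \<noteq> 0}"
    by (rule inj_on_subset[OF inj_char]) auto
  show "finite {chi \<in> even_characters p. theta p x chi \<noteq> 0}" using finite_even_characters by simp
qed (use char_even in auto)

text \<open>The product inequality holds for every admissible weight. Applied to the constant weight
  it shows that the count is positive; division by the count then carries the bound over to the
  infimum, which is therefore positive too.\<close>

lemma min_energy_level_bounds:
  assumes "x > 0"
  defines "c \<equiv> exp (- pi * x / 3) ^ 4 * (1 - exp (- pi * x)) ^ 4 / 192"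
  shows "min_energy level > 0"
    and "real (card {chi \<in> even_characters p. theta p x chi \<noteq> 0}) \<ge> c * (real p / min_energy level)"
proof -
  define n where "n = real (card {chi \<in> even_characters p. theta p x chi \<noteq> 0})"
  define q where "q w = level\<^sup>2 * weighted_energy level w / weight_norm level w ^ 4" for w
  have c: "c > 0" using assms(1) by (simp add: c_def)
  have p0: "real p > 0" using p_gt_2 by simp
  have l1: "level \<ge> 1" using p_gt_2 by (simp add: level_def)
  have adm: "admissible_weight level (\<lambda>_. 1)"
    using l1 by (auto simp: admissible_weight_def pos_upto_def intro!: exI[of _ 1])
  have qn: "c * real p \<le> n * q w" if w: "admissible_weight level w" for w
  proof -
    have "weighted_energy level w \<ge> 0"
      unfolding weighted_energy_def using w by (intro sum_nonneg) (auto simp: admissible_weight_def)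
    hence q0: "q w \<ge> 0" by (simp add: q_def)
    have "c * real p \<le> real (card {j\<in>{..<H}. theta p x (char j) \<noteq> 0}) * q w"
      using nonvanishing_times_energy_ge[OF assms(1) w] by (simp add: c_def q_def)
    also have "\<dots> \<le> n * q w"
      unfolding n_def using card_nonvanishing_le q0 by (intro mult_right_mono) auto
    finally show ?thesis .
  qed
  have cp: "c * real p > 0" using c p0 by simp
  have n: "n > 0"
  proof (rule ccontr)
    assume "\<not> n > 0"
    hence "n = 0" by (simp add: n_def)
    thus False using qn[OF adm] cp by simp
  qed
  have "c * real p / n \<le> min_energy level"
    unfolding min_energy_def
  proof (rule cINF_greatest)
    show "{w. admissible_weight level w} \<noteq> {}" using adm by blast
    fix w assume "w \<in> {w. admissible_weight level w}"
    hence "c * real p \<le> n * q w" using qn by simp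
    hence "c * real p / n \<le> q w" using n by (simp add: field_simps)
    thus "c * real p / n \<le> level\<^sup>2 * weighted_energy level w / weight_norm level w ^ 4" by (simp only: q_def)
  qed
  moreover have "c * real p / n > 0" using cp n by simp
  ultimately show pos: "min_energy level > 0" by linarith
  show "n \<ge> c * (real p / min_energy level)"
    using \<open>c * real p / n \<le> min_energy level\<close> n pos by (simp add: field_simps)
qed

end

section \<open>Conclusion\<close>

lemma delta_nonneg: "delta \<ge> 0"
proof -
  have "ln (ln 2) \<le> ln 2 - (1::real)" by (rule ln_le_minus_one) simp
  hence "(1 + ln (ln 2)) / ln 2 \<le> (1::real)" by simp
  thus ?thesis by (simp add: delta_def)
qed

theorem theorem4:
  fixes x :: real
  assumes "x > 0"
  shows "\<exists>c1>0. \<exists>c2>0. \<exists>\<epsilon> :: nat \<Rightarrow> real. \<exists>p0 :: nat.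
    \<epsilon> \<longlonglongrightarrow> 0 \<and>
    (\<forall>p\<ge>p0. prime p \<longrightarrow>
       real (card {chi \<in> even_characters p. theta p x chi \<noteq> 0})
         \<ge> c1 * (real p / min_energy (sqrt (real p / 3))) \<and>
       real p / min_energy (sqrt (real p / 3))
         \<ge> c2 * (real p / ln (real p) powr (delta + \<epsilon> p)))"
proof -
  define c1 where "c1 = exp (- pi * x / 3) ^ 4 * (1 - exp (- pi * x)) ^ 4 / 192"
  define me where "me p = min_energy (sqrt (real p / 3))" for p :: nat
  \<comment> \<open>The excess of the actual exponent over \<open>delta\<close>, clipped at 0. The
    second inequality then holds by construction with constant 1, and only the convergence of
    \<open>\<epsilon>\<close> uses the energy bound.\<close>
  define \<epsilon> where "\<epsilon> p = (if me p > 0 then max 0 (ln (me p) / ln (ln (real p)) - delta) else 0)" for p :: nat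
  have c1: "c1 > 0" using assms by (simp add: c1_def)
  have "\<epsilon> \<longlonglongrightarrow> 0"
  proof (rule order_tendstoI)
    fix a :: real assume "a < 0"
    thus "\<forall>\<^sub>F p in sequentially. a < \<epsilon> p" by (simp add: \<epsilon>_def less_max_iff_disj)
  next
    fix a :: real assume a: "0 < a"
    have "filterlim (\<lambda>p::nat. sqrt (real p / 3)) at_top sequentially" by real_asymp
    hence "\<forall>\<^sub>F p in sequentially. me p \<le> ln (sqrt (real p / 3)) powr (delta + a / 2)"
      unfolding me_def by (rule eventually_compose_filterlim[OF min_energy_upper, rotated]) (use a in simp)
    moreover have "\<forall>\<^sub>F p::nat in sequentially. real p > exp (exp 1)"
      using filterlim_real_sequentially unfolding filterlim_at_top_dense by blast
    moreover have "\<forall>\<^sub>F p::nat in sequentially. ln (sqrt (real p / 3)) \<ge> 1"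
    proof -
      have "filterlim (\<lambda>p::nat. ln (sqrt (real p / 3))) at_top sequentially" by real_asymp
      thus ?thesis unfolding filterlim_at_top by blast
    qed
    ultimately show "\<forall>\<^sub>F p in sequentially. \<epsilon> p < a"
    proof eventually_elim
      case (elim p)
      have p0: "real p > 0" using elim(2) exp_gt_zero[of "exp 1 :: real"] by linarith
      have "ln (exp (exp 1)) < ln (real p)" using elim(2) p0 by (subst ln_less_cancel_iff) auto
      hence lnp: "exp 1 < ln (real p)" by simp
      hence "ln (real p) > 0" using exp_gt_zero[of "1 :: real"] by linarith
      hence "ln (exp 1) < ln (ln (real p))" using lnp by (subst ln_less_cancel_iff) auto
      hence ll: "ln (ln (real p)) > 1" by simp
      show "\<epsilon> p < a"
      proof (cases "me p > 0")
        case True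
        define y where "y = sqrt (real p / 3)"
        have p1: "real p \<ge> 1" using p0 by simp
        have yp: "y \<le> real p"
        proof -
          have "real p / 3 \<le> (real p)\<^sup>2" using p1 mult_mono[of 1 "real p" "real p" "real p"] by (simp add: power2_eq_square)
          hence "sqrt (real p / 3) \<le> sqrt ((real p)\<^sup>2)" by (rule real_sqrt_le_mono)
          thus ?thesis by (simp add: y_def)
        qed
        have y0: "y > 0" using p1 by (simp add: y_def)
        have "ln y \<le> ln (real p)" using yp y0 by (intro ln_mono) auto
        moreover have "ln y \<ge> 1" using elim(3) by (simp only: y_def)
        ultimately have lly: "ln (ln y) \<le> ln (ln (real p))" and lly0: "ln (ln y) \<ge> 0" and lny: "ln y > 0"
          by simp_all
        have "ln (me p) \<le> ln (ln y powr (delta + a / 2))"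
          using True elim(1) by (intro ln_mono) (simp_all add: y_def)
        also have "\<dots> = (delta + a / 2) * ln (ln y)" using lny by (simp add: ln_powr)
        \<comment> \<open>Passing from ln ln y to ln ln p requires a nonnegative factor; as
          \<open>delta\<close> is nonnegative, the maximum equals
          \<open>delta + a / 2\<close>.\<close>
        also have "\<dots> \<le> max 0 (delta + a / 2) * ln (ln (real p))"
          using lly lly0 by (intro mult_mono) auto
        finally have "ln (me p) / ln (ln (real p)) \<le> max 0 (delta + a / 2)"
          using ll by (simp add: field_simps)
        thus ?thesis using True a delta_nonneg by (simp add: \<epsilon>_def)
      qed (use a in \<open>simp add: \<epsilon>_def\<close>)
    qed
  qed
  \<comment> \<open>The bound on \<open>p\<close> ensures that \<open>p\<close> is odd and that ln
    ln p is positive.\<close>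
  moreover have "real (card {chi \<in> even_characters p. theta p x chi \<noteq> 0}) \<ge> c1 * (real p / me p) \<and>
       real p / me p \<ge> 1 * (real p / ln (real p) powr (delta + \<epsilon> p))"
    if p: "p \<ge> 16" "prime p" for p
  proof -
    obtain g where g: "residue_primroot p g" using prime_primitive_root_exists[of p] p prime_gt_1_nat by blast
    define H where "H = (p - 1) div 2"
    have "odd p" using p prime_odd_nat by simp
    hence H: "p = 2 * H + 1" "H > 0" unfolding H_def using p by auto
    interpret odd_prime_primroot p g H by unfold_locales (use p g H in auto)
    have lev: "level = sqrt (real p / 3)" by (simp add: level_def)
    note b = min_energy_level_bounds[OF assms, folded c1_def, unfolded lev, folded me_def]
    have "exp 1 < real p" using exp_le p(1) by linarith
    hence "ln (exp 1) < ln (real p)" by (subst ln_less_cancel_iff) (use p(1) in auto)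
    hence lp: "ln (real p) > 1" by simp
    hence ll: "ln (ln (real p)) > 0" by simp
    have "me p = exp (ln (me p))" using b(1) by simp
    also have "\<dots> = exp (ln (me p) / ln (ln (real p)) * ln (ln (real p)))" using ll by simp
    also have "\<dots> \<le> exp ((delta + \<epsilon> p) * ln (ln (real p)))"
    proof -
      have "ln (me p) / ln (ln (real p)) \<le> delta + \<epsilon> p" using b(1) by (simp add: \<epsilon>_def)
      hence "ln (me p) / ln (ln (real p)) * ln (ln (real p)) \<le> (delta + \<epsilon> p) * ln (ln (real p))"
        using ll by (intro mult_right_mono) auto
      thus ?thesis by (simp only: exp_le_cancel_iff)
    qed
    also have "\<dots> = ln (real p) powr (delta + \<epsilon> p)" using lp by (simp add: powr_def)
    finally have "real p / ln (real p) powr (delta + \<epsilon> p) \<le> real p / me p"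
      using b(1) p by (intro divide_left_mono) auto
    thus ?thesis using b(2) by simp
  qed
  ultimately show ?thesis
    using c1 unfolding me_def by (intro exI[of _ c1] conjI exI[of _ 1] exI[of _ \<epsilon>] exI[of _ 16]) auto
qed

end
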